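(* Let $N\ge 2$, let $\Sigma_N^+=\prod_{i=0}^\infty\{1,\ldots,N\}$ with its product $\sigma$-algebra, and let $\mu=\bigotimes_{i=0}^\infty\mu'$, where $\mu'$ is a probability measure on $\{1,\ldots,N\}$ of full support. Let $d$ be the metric $d(\sigma,\tau)=2^{-I(\sigma,\tau)}$, where $I(\sigma,\tau)=\min\{i\ge 0:\sigma_i\ne\tau_i\}$ (and $d(\sigma,\sigma)=0$), and let $T$ be the one-sided Bernoulli shift $T((\sigma_0,\sigma_1,\sigma_2,\ldots))=(\sigma_1,\sigma_2,\sigma_3,\ldots)$. Then $$\frac{1}{a_T^*(\sigma)}=h_\mu(T)$$ for $\mu$-a.e. $\sigma\in\Sigma_N^+$, where $a_T^*$ is the minimal asymptotic rate function of $T$ and $h_\mu(T)$ is the metric (measure-theoretic) entropy of $T$.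
   Context: $B_r(x)=\{y: d(x,y)<r\}$ is the open ball, and $\log$ is the natural logarithm (also in the definition of entropy). For a measurable nonsingular transformation $T$ of a probability space $(X,\mu)$ with metric $d$ and a point $x\in X$, a pair $(\delta,a)$ with $\delta>0$, $a>0$ is called a sensitivity constant and asymptotic rate at $x$ if for every $\varepsilon>0$ there exists an integer $n\ge 0$ with $n\le -a\log\mu(B_\varepsilon(x))$ and $\mu\{y\in B_\varepsilon(x): d(T^nx,T^ny)>\delta\}>0$. $T$ is restricted sensitive if such a pair exists for $\mu$-a.e. $x$. The minimal asymptotic rate at $x$ is $$a_T^*(x)=\inf\{a>0 : \text{there exists } \delta>0 \text{ such that } (\delta,a) \text{ is a sensitivity constant and asymptotic rate at } x\}.$$ *)

theory Defs
  imports "HOL-Probability.Probability"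
begin

section \<open>Kolmogorov--Sinai entropy\<close>

text \<open>
  Partitions are literal partitions of \<^term>\<open>space M\<close> into nonempty sets, hence the removal of the
  empty set in joins and preimages (it would contribute nothing to the entropy anyway).
\<close>

definition partition_join :: "'a set set \<Rightarrow> 'a set set \<Rightarrow> 'a set set" where
  "partition_join P Q = {A \<inter> B | A B. A \<in> P \<and> B \<in> Q} - {{}}"

definition partition_vimage :: "'a measure \<Rightarrow> ('a \<Rightarrow> 'a) \<Rightarrow> 'a set set \<Rightarrow> 'a set set" where
  "partition_vimage M T P = {T -` A \<inter> space M | A. A \<in> P} - {{}}"

text \<open>\<open>iterated_join M T P n\<close> is \<open>\<Or>\<^bsub>i<n\<^esub> T\<^sup>-\<^sup>i P\<close>.\<close>

primrec iterated_join :: "'a measure \<Rightarrow> ('a \<Rightarrow> 'a) \<Rightarrow> 'a set set \<Rightarrow> nat \<Rightarrow> 'a set set" where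
  "iterated_join M T P 0 = {space M} - {{}}"
| "iterated_join M T P (Suc n) =
     partition_join (iterated_join M T P n) (partition_vimage M (T ^^ n) P)"

text \<open>The convention \<open>0 log 0 = 0\<close> holds because \<^prop>\<open>ln (0::real) = 0\<close>.\<close>

definition partition_entropy :: "'a measure \<Rightarrow> 'a set set \<Rightarrow> real" where
  "partition_entropy M P = - (\<Sum>A\<in>P. measure M A * ln (measure M A))"

definition entropy_wrt_partition :: "'a measure \<Rightarrow> ('a \<Rightarrow> 'a) \<Rightarrow> 'a set set \<Rightarrow> real" where
  "entropy_wrt_partition M T P =
     lim (\<lambda>n. partition_entropy M (iterated_join M T P n) / real n)"

definition finite_measurable_partition :: "'a measure \<Rightarrow> 'a set set \<Rightarrow> bool" where
  "finite_measurable_partition M P \<longleftrightarrow> finite P \<and> P \<subseteq> sets M \<and> partition_on (space M) P"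

definition metric_entropy :: "'a measure \<Rightarrow> ('a \<Rightarrow> 'a) \<Rightarrow> ereal" where
  "metric_entropy M T =
     (SUP P\<in>{P. finite_measurable_partition M P}. ereal (entropy_wrt_partition M T P))"


section \<open>Sensitivity and the minimal asymptotic rate\<close>

text \<open>
  If the ball is a null set then \<open>-log 0\<close> should be \<open>\<infinity>\<close> whereas \<^prop>\<open>ln (0::real) = 0\<close>; this makes no
  difference, since then the last conjunct is false for every \<open>n\<close>.
\<close>

definition sensitivity_pair ::
  "'a measure \<Rightarrow> ('a \<Rightarrow> 'a \<Rightarrow> real) \<Rightarrow> ('a \<Rightarrow> 'a) \<Rightarrow> 'a \<Rightarrow> real \<Rightarrow> real \<Rightarrow> bool" where
  "sensitivity_pair M d T x \<delta> a \<longleftrightarrow> \<delta> > 0 \<and> a > 0 \<and>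
     (\<forall>\<epsilon>>0. \<exists>n::nat.
        real n \<le> - a * ln (measure M (Metric_space.mball (space M) d x \<epsilon>)) \<and>
        measure M {y \<in> Metric_space.mball (space M) d x \<epsilon>. d ((T ^^ n) x) ((T ^^ n) y) > \<delta>} > 0)"

text \<open>Extended-real valued, so that the infimum of the empty set is \<open>\<infinity>\<close>.\<close>

definition minimal_asymptotic_rate ::
  "'a measure \<Rightarrow> ('a \<Rightarrow> 'a \<Rightarrow> real) \<Rightarrow> ('a \<Rightarrow> 'a) \<Rightarrow> 'a \<Rightarrow> ereal" where
  "minimal_asymptotic_rate M d T x =
     Inf {ereal a | a. a > 0 \<and> (\<exists>\<delta>>0. sensitivity_pair M d T x \<delta> a)}"


section \<open>The one-sided Bernoulli shift\<close>

definition bernoulli_measure :: "'s measure \<Rightarrow> (nat \<Rightarrow> 's) measure" where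
  "bernoulli_measure M' = PiM UNIV (\<lambda>_. M')"

definition seq_shift :: "(nat \<Rightarrow> 's) \<Rightarrow> (nat \<Rightarrow> 's)" where
  "seq_shift \<sigma> = (\<lambda>i. \<sigma> (Suc i))"

definition seq_dist :: "(nat \<Rightarrow> 's) \<Rightarrow> (nat \<Rightarrow> 's) \<Rightarrow> real" where
  "seq_dist \<sigma> \<tau> = (if \<sigma> = \<tau> then 0 else (1 / 2) ^ (LEAST i. \<sigma> i \<noteq> \<tau> i))"

lemma seq_dist_ultra: "seq_dist \<sigma> \<upsilon> \<le> max (seq_dist \<sigma> \<tau>) (seq_dist \<tau> \<upsilon>)"
proof (cases "\<sigma> = \<upsilon> \<or> \<sigma> = \<tau> \<or> \<tau> = \<upsilon>")
  case True
  then show ?thesis by (auto simp: seq_dist_def le_max_iff_disj)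
next
  case False
  define i where "i = (LEAST i. \<sigma> i \<noteq> \<upsilon> i)"
  have "\<exists>i. \<sigma> i \<noteq> \<upsilon> i" using False by auto
  then have "\<sigma> i \<noteq> \<upsilon> i" unfolding i_def by (rule LeastI_ex)
  then have "\<sigma> i \<noteq> \<tau> i \<or> \<tau> i \<noteq> \<upsilon> i" by auto
  then have "(LEAST i. \<sigma> i \<noteq> \<tau> i) \<le> i \<or> (LEAST i. \<tau> i \<noteq> \<upsilon> i) \<le> i"
    by (auto intro: Least_le)
  then have "(1 / 2 :: real) ^ i \<le> (1 / 2) ^ (LEAST i. \<sigma> i \<noteq> \<tau> i) \<or>
             (1 / 2 :: real) ^ i \<le> (1 / 2) ^ (LEAST i. \<tau> i \<noteq> \<upsilon> i)"
    by (auto intro: power_decreasing)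
  then show ?thesis using False by (auto simp: seq_dist_def i_def[symmetric] le_max_iff_disj)
qed

lemma Metric_space_seq_dist: "Metric_space S seq_dist"
proof
  show nonneg: "0 \<le> seq_dist \<sigma> \<tau>" for \<sigma> \<tau> :: "nat \<Rightarrow> 'a" by (simp add: seq_dist_def)
  show "seq_dist \<sigma> \<tau> = seq_dist \<tau> \<sigma>" for \<sigma> \<tau> :: "nat \<Rightarrow> 'a"
    by (simp add: seq_dist_def eq_commute)
  show "seq_dist \<sigma> \<tau> = 0 \<longleftrightarrow> \<sigma> = \<tau>" for \<sigma> \<tau> :: "nat \<Rightarrow> 'a" by (simp add: seq_dist_def)
  show "seq_dist \<sigma> \<upsilon> \<le> seq_dist \<sigma> \<tau> + seq_dist \<tau> \<upsilon>" for \<sigma> \<tau> \<upsilon> :: "nat \<Rightarrow> 'a"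
    using seq_dist_ultra[of \<sigma> \<upsilon> \<tau>] nonneg[of \<sigma> \<tau>] nonneg[of \<tau> \<upsilon>] by linarith
qed

end

theory Submission
  imports Defs
begin

text \<open>
  Let \<open>h\<close> be the entropy \<open>- \<Sum> p\<^sub>s ln p\<^sub>s\<close> of a letter. Both sides of the identity are equal
  to \<open>h\<close>, and both for the same reason: the information content \<open>- ln \<mu>(C)\<close> of the cylinder
  \<open>C\<close> of length \<open>m\<close> about \<open>\<sigma>\<close> is the sum of the information contents of the letters
  \<open>\<sigma>\<^sub>0, \<dots>, \<sigma>\<^sub>m\<^sub>-\<^sub>1\<close>, whose mean is \<open>m h\<close> and which almost surely is asymptotic to \<open>m h\<close>.

  For the entropy of the shift, the partition according to the letter at time \<open>0\<close> has rate
  \<open>h\<close>, since its iterated joins consist of cylinders. That no finite measurable partition has a larger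
  rate is the Kolmogorov--Sinai theorem (\<open>kolmogorov_sinai_generator\<close>). It rests on the
  submodularity of entropy and on the fact that a generating sequence of finite partitions eventually
  leaves arbitrarily little conditional entropy in any given finite partition
  (\<open>conditional_entropy_generating_small\<close>); the latter comes from approximating measurable sets
  by sets of a generating algebra. Fekete's lemma provides the existence of the rates.

  For the minimal asymptotic rate, the balls of the metric are exactly the cylinders. Two points of a
  cylinder of length \<open>m\<close> need about \<open>m\<close> steps, up to a constant that depends only on \<open>\<delta>\<close>, before
  their orbits can be \<open>\<delta>\<close>-apart, and after \<open>m\<close> steps a set of positive measure has
  been separated from \<open>\<sigma>\<close>. So \<open>a\<close> is an admissible rate when \<open>m\<close> is less than \<open>a\<close> times the
  information content \<open>\<approx> m h\<close> of the cylinder, that is when \<open>a > 1 / h\<close>, and it is not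
  admissible when \<open>a < 1 / h\<close> (\<open>rate_lower_bound\<close> and \<open>rate_upper_bound\<close>). The almost sure
  asymptotics of the information content is a strong law of large numbers, which for these bounded
  variables follows from Hoeffding's inequality and the Borel--Cantelli lemma.
\<close>

section \<open>Entropy of a simple function\<close>

text \<open>
  Finite measurable partitions are handled through functions that label their cells: joins become
  pairs, preimages become compositions, and two labellings have the same entropy as soon as they
  identify the same points. Only fibres over attained values occur, so that no cell is empty.
\<close>

definition fibres :: "'a measure \<Rightarrow> ('a \<Rightarrow> 'b) \<Rightarrow> 'a set set" where
  "fibres M X = (\<lambda>x. {y \<in> space M. X y = X x}) ` space M"

abbreviation fibre_entropy :: "'a measure \<Rightarrow> ('a \<Rightarrow> 'b) \<Rightarrow> real" where
  "fibre_entropy M X \<equiv> partition_entropy M (fibres M X)"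

lemma fibres_cong:
  assumes "\<And>x y. x \<in> space M \<Longrightarrow> y \<in> space M \<Longrightarrow> X x = X y \<longleftrightarrow> Y x = Y y"
  shows "fibres M X = fibres M Y"
  unfolding fibres_def using assms by (intro image_cong) auto

lemma simple_function_vimage_sets:
  assumes "simple_function M X"
  shows "{x \<in> space M. X x = v} \<in> sets M"
proof -
  have "{x \<in> space M. X x = v} = X -` {v} \<inter> space M" by auto
  then show ?thesis using simple_functionD(2)[OF assms] by metis
qed

text \<open>
  Unattained values have empty fibres and contribute nothing, so the index set may be any finite set
  of values; this allows the range of a pair to be replaced by a product.
\<close>

lemma fibre_entropy_eq_sum:
  assumes X: "simple_function M X" and A: "finite A" "X ` space M \<subseteq> A"
  shows "fibre_entropy M X =
    - (\<Sum>v\<in>A. measure M {x \<in> space M. X x = v} * ln (measure M {x \<in> space M. X x = v}))"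
proof -
  let ?f = "\<lambda>v. {x \<in> space M. X x = v}"
  have *: "fibres M X = ?f ` (X ` space M)" by (auto simp: fibres_def)
  have "inj_on ?f (X ` space M)" by (auto simp: inj_on_def set_eq_iff)
  then have "fibre_entropy M X = - (\<Sum>v\<in>X ` space M. measure M (?f v) * ln (measure M (?f v)))"
    unfolding partition_entropy_def * by (simp add: sum.reindex)
  also have "(\<Sum>v\<in>X ` space M. measure M (?f v) * ln (measure M (?f v))) =
      (\<Sum>v\<in>A. measure M (?f v) * ln (measure M (?f v)))"
  proof (intro sum.mono_neutral_left A ballI)
    fix v assume "v \<in> A - X ` space M"
    then have "?f v = {}" by auto
    then show "measure M (?f v) * ln (measure M (?f v)) = 0" by (metis measure_empty mult_zero_left)
  qed
  finally show ?thesis .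
qed

lemma fibre_entropy_nonneg:
  assumes "prob_space M"
  shows "0 \<le> fibre_entropy M X"
proof -
  interpret prob_space M by fact
  have "measure M A * ln (measure M A) \<le> 0" for A
    by (cases "measure M A = 0")
       (auto intro!: mult_nonneg_nonpos simp: zero_less_measure_iff)
  then show ?thesis by (auto simp: partition_entropy_def intro!: sum_nonpos)
qed

context prob_space
begin

text \<open>
  The link to information theory: in base \<^term>\<open>exp 1\<close> the entropy of a random variable is that
  of the partition into its fibres, so data processing and the nonnegativity of mutual information
  become available for partitions.
\<close>

lemma fibre_entropy_eq_entropy:
  assumes X: "simple_function M X"
  shows "fibre_entropy M X = entropy (exp 1) (count_space (X ` space M)) X"
proof -
  interpret information_space M "exp 1" by standard simp
  have *: "X -` {v} \<inter> space M = {x \<in> space M. X x = v}" for v by auto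
  show ?thesis
    unfolding fibre_entropy_eq_sum[OF X simple_functionD(1)[OF X] order_refl]
    by (subst entropy_simple_distributed[OF simple_distributedI[OF X measure_nonneg refl]])
       (simp add: * flip: log_ln)
qed

text \<open>
  The finer labelling determines the coarser one, so this is the data processing inequality.
\<close>

lemma fibre_entropy_mono:
  assumes X: "simple_function M X" and Y: "simple_function M Y"
    and "\<And>x y. x \<in> space M \<Longrightarrow> y \<in> space M \<Longrightarrow> Y x = Y y \<Longrightarrow> X x = X y"
  shows "fibre_entropy M X \<le> fibre_entropy M Y"
proof -
  interpret information_space M "exp 1" by standard simp
  define f where "f v = X (SOME x. x \<in> space M \<and> Y x = v)" for v
  have f: "(f \<circ> Y) x = X x" if "x \<in> space M" for x
  proof -
    have "(SOME z. z \<in> space M \<and> Y z = Y x) \<in> space M \<and> Y (SOME z. z \<in> space M \<and> Y z = Y x) = Y x"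
      by (rule someI[of _ x]) (use that in auto)
    then show ?thesis unfolding f_def comp_def using assms(3) that by blast
  qed
  have "fibre_entropy M X = fibre_entropy M (f \<circ> Y)"
    using f by (intro arg_cong[where f="partition_entropy M"] fibres_cong) (simp del: comp_apply)
  also have "\<dots> \<le> fibre_entropy M Y"
    using entropy_data_processing[OF Y] simple_function_compose[OF Y]
    by (simp add: fibre_entropy_eq_entropy Y)
  finally show ?thesis .
qed

lemma sum_simple_function_eq_expectation:
  fixes h :: "'b \<Rightarrow> real"
  assumes X: "simple_function M X"
  shows "(\<Sum>v\<in>X ` space M. measure M {x \<in> space M. X x = v} * h v) = expectation (\<lambda>x. h (X x))"
proof -
  have *: "X -` {v} \<inter> space M = {x \<in> space M. X x = v}" for v by auto
  have "distributed M (count_space (X ` space M)) X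
      (\<lambda>v. ennreal (measure M {x \<in> space M. X x = v}))"
    by (rule simple_distributed[OF simple_distributedI[OF X]]) (auto simp: *)
  from distributed_integral[OF this, of h] show ?thesis
    using simple_functionD(1)[OF X] by (simp add: lebesgue_integral_count_space_finite)
qed

text \<open>
  Entropy is the mean information content of the cell of a random point. Read this way, additivity
  of the entropy of independent letters is linearity of the expectation.
\<close>

lemma fibre_entropy_eq_expectation:
  assumes X: "simple_function M X"
  shows "fibre_entropy M X = expectation (\<lambda>x. - ln (measure M {y \<in> space M. X y = X x}))"
  unfolding fibre_entropy_eq_sum[OF X simple_functionD(1)[OF X] order_refl]
  by (subst sum_simple_function_eq_expectation[OF X, symmetric]) (simp add: sum_negf)

lemma AE_fibre_positive:
  assumes X: "simple_function M X"
  shows "AE x in M. measure M {y \<in> space M. X y = X x} > 0"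
proof -
  have "AE x in M. X x \<noteq> v" if "measure M {y \<in> space M. X y = v} = 0" for v
    using that simple_function_vimage_sets[OF X, of v]
    by (intro AE_I[of _ _ "{y \<in> space M. X y = v}"]) (auto simp: emeasure_eq_measure)
  then have "AE x in M. \<forall>v\<in>X ` space M. measure M {y \<in> space M. X y = v} = 0 \<longrightarrow> X x \<noteq> v"
    using simple_functionD(1)[OF X] by (subst AE_finite_all) auto
  then show ?thesis
    by (rule AE_mp) (auto intro!: AE_I2 simp: zero_less_measure_iff)
qed

lemma integrable_simple_function_compose:
  fixes h :: "'b \<Rightarrow> real"
  assumes X: "simple_function M X"
  shows "integrable M (\<lambda>x. h (X x))"
proof -
  have s: "simple_function M (\<lambda>x. h (X x))" using simple_function_compose[OF X, of h] by (simp add: comp_def)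
  have "finite ((\<lambda>x. h (X x)) ` space M)" using s by (rule simple_functionD)
  then obtain B where "\<forall>y\<in>(\<lambda>x. h (X x)) ` space M. norm y \<le> B"
    using finite_imp_bounded bounded_iff by metis
  then show ?thesis
    using borel_measurable_simple_function[OF s] by (intro integrable_const_bound[of _ B]) auto
qed

text \<open>
  In terms of entropies, this is the nonnegativity of the conditional mutual information of
  \<open>X\<close> and \<open>Y\<close> given \<open>Z\<close>; equivalently, conditioning on more can only lower the
  entropy of \<open>X\<close>. The logarithm of the quotient of probabilities may be split into a sum
  because, almost surely, a point lies in cells of positive measure.
\<close>

lemma fibre_entropy_submodular:
  assumes X: "simple_function M X" and Y: "simple_function M Y" and Z: "simple_function M Z"
  shows "fibre_entropy M (\<lambda>x. (X x, Y x, Z x)) + fibre_entropy M Z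
    \<le> fibre_entropy M (\<lambda>x. (X x, Z x)) + fibre_entropy M (\<lambda>x. (Y x, Z x))"
proof -
  interpret information_space M "exp 1" by standard simp
  have XZ: "simple_function M (\<lambda>x. (X x, Z x))" and YZ: "simple_function M (\<lambda>x. (Y x, Z x))"
    and XYZ: "simple_function M (\<lambda>x. (X x, Y x, Z x))"
    using X Y Z by (auto intro!: simple_function_Pair)
  define pz where "pz v = measure M {x \<in> space M. Z x = v}" for v
  define pxz where "pxz v = measure M {x \<in> space M. (X x, Z x) = v}" for v
  define pyz where "pyz v = measure M {x \<in> space M. (Y x, Z x) = v}" for v
  define p where "p v = measure M {x \<in> space M. (X x, Y x, Z x) = v}" for v
  have sd: "simple_distributed M Z pz" "simple_distributed M (\<lambda>x. (Y x, Z x)) pyz"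
    "simple_distributed M (\<lambda>x. (X x, Z x)) pxz" "simple_distributed M (\<lambda>x. (X x, Y x, Z x)) p"
    using Z XZ YZ XYZ
    by (auto intro!: simple_distributedI arg_cong[where f=prob] simp: pz_def pxz_def pyz_def p_def)
  let ?g = "\<lambda>(x, y, z). ln (p (x, y, z) / (pxz (x, z) * (pyz (y, z) / pz z)))"
  have pos: "AE x in M. p (X x, Y x, Z x) > 0 \<and> pxz (X x, Z x) > 0 \<and> pyz (Y x, Z x) > 0 \<and> pz (Z x) > 0"
    using AE_fibre_positive[OF Z] AE_fibre_positive[OF XZ] AE_fibre_positive[OF YZ]
      AE_fibre_positive[OF XYZ]
    by (simp add: pz_def pxz_def pyz_def p_def)
  have "0 \<le> conditional_mutual_information (exp 1) (count_space (X ` space M))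
      (count_space (Y ` space M)) (count_space (Z ` space M)) X Y Z"
    by (rule conditional_mutual_information_nonneg[OF X Y Z])
  also have "\<dots> = (\<Sum>v\<in>(\<lambda>x. (X x, Y x, Z x))`space M. p v * ?g v)"
    by (subst conditional_mutual_information_eq[OF sd]) (simp add: log_ln case_prod_beta)
  also have "\<dots> = expectation (\<lambda>x. ?g (X x, Y x, Z x))"
    unfolding p_def by (rule sum_simple_function_eq_expectation[OF XYZ])
  also have "\<dots> = expectation (\<lambda>x. (- ln (pxz (X x, Z x)) + - ln (pyz (Y x, Z x)))
      - (- ln (p (X x, Y x, Z x)) + - ln (pz (Z x))))"
  proof (rule integral_cong_AE)
    show "AE x in M. ?g (X x, Y x, Z x) = (- ln (pxz (X x, Z x)) + - ln (pyz (Y x, Z x)))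
      - (- ln (p (X x, Y x, Z x)) + - ln (pz (Z x)))"
      using pos by eventually_elim (auto simp: ln_div ln_mult)
    have *: "(\<lambda>x. h (X x, Y x, Z x)) \<in> borel_measurable M" for h :: "_ \<Rightarrow> real"
      using integrable_simple_function_compose[OF XYZ, of h] by blast
    show "(\<lambda>x. ?g (X x, Y x, Z x)) \<in> borel_measurable M" by (rule *)
    show "(\<lambda>x. (- ln (pxz (X x, Z x)) + - ln (pyz (Y x, Z x)))
      - (- ln (p (X x, Y x, Z x)) + - ln (pz (Z x)))) \<in> borel_measurable M"
      using *[of "\<lambda>(a, b, c). (- ln (pxz (a, c)) + - ln (pyz (b, c))) - (- ln (p (a, b, c)) + - ln (pz c))"]
      by simp
  qed
  also have "\<dots> = (fibre_entropy M (\<lambda>x. (X x, Z x)) + fibre_entropy M (\<lambda>x. (Y x, Z x)))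
      - (fibre_entropy M (\<lambda>x. (X x, Y x, Z x)) + fibre_entropy M Z)"
  proof -
    have i: "integrable M (\<lambda>x. - ln (pz (Z x)))" "integrable M (\<lambda>x. - ln (pxz (X x, Z x)))"
      "integrable M (\<lambda>x. - ln (pyz (Y x, Z x)))" "integrable M (\<lambda>x. - ln (p (X x, Y x, Z x)))"
      using integrable_simple_function_compose[OF Z] integrable_simple_function_compose[OF XZ]
       integrable_simple_function_compose[OF YZ] integrable_simple_function_compose[OF XYZ] by auto
    have lin: "expectation (\<lambda>x. (a x + b x) - (c x + d x)) =
        (expectation a + expectation b) - (expectation c + expectation d)"
      if "integrable M a" "integrable M b" "integrable M c" "integrable M d" for a b c d :: "_ \<Rightarrow> real"
      using that by simp
    show ?thesis
      unfolding fibre_entropy_eq_expectation[OF Z] fibre_entropy_eq_expectation[OF XZ]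
        fibre_entropy_eq_expectation[OF YZ] fibre_entropy_eq_expectation[OF XYZ]
        pz_def[symmetric] pxz_def[symmetric] pyz_def[symmetric] p_def[symmetric]
      by (rule lin[OF i(2,3,4,1)])
  qed
  finally show ?thesis by simp
qed

text \<open>Submodularity relative to the trivial partition.\<close>

lemma fibre_entropy_subadditive:
  assumes X: "simple_function M X" and Y: "simple_function M Y"
  shows "fibre_entropy M (\<lambda>x. (X x, Y x)) \<le> fibre_entropy M X + fibre_entropy M Y"
proof -
  have "fibre_entropy M (\<lambda>_. ()) = 0"
    using fibre_entropy_eq_sum[of M "\<lambda>_. ()" "{()}"] by (simp add: prob_space image_subset_iff)
  moreover have "fibres M (\<lambda>x. (X x, Y x, ())) = fibres M (\<lambda>x. (X x, Y x))"
    "fibres M (\<lambda>x. (X x, ())) = fibres M X" "fibres M (\<lambda>x. (Y x, ())) = fibres M Y"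
    by (auto intro!: fibres_cong)
  ultimately show ?thesis using fibre_entropy_submodular[OF X Y, of "\<lambda>_. ()"] by simp
qed

lemma fibre_entropy_compose_measure_preserving:
  assumes X: "simple_function M X" and T: "T \<in> measurable M M" "distr M M T = M"
  shows "simple_function M (\<lambda>x. X (T x))"
    and "fibre_entropy M (\<lambda>x. X (T x)) = fibre_entropy M X"
proof -
  note Tsp = measurable_space[OF T(1)]
  have vim: "{x \<in> space M. X (T x) = v} = T -` {x \<in> space M. X x = v} \<inter> space M" for v
    using Tsp by auto
  have sub: "(\<lambda>x. X (T x)) ` space M \<subseteq> X ` space M" using Tsp by auto
  show XT: "simple_function M (\<lambda>x. X (T x))"
    unfolding simple_function_def
  proof (intro conjI ballI)
    show "finite ((\<lambda>x. X (T x)) ` space M)" using sub simple_functionD(1)[OF X] finite_subset by blast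
    fix v show "(\<lambda>x. X (T x)) -` {v} \<inter> space M \<in> sets M"
      using measurable_sets[OF T(1) simple_function_vimage_sets[OF X, of v]] vim[of v]
      by (simp add: vimage_def Int_def conj_commute)
  qed
  have "measure M {x \<in> space M. X (T x) = v} = measure M {x \<in> space M. X x = v}" for v
    unfolding vim using measure_distr[OF T(1) , of "{x \<in> space M. X x = v}"]
      simple_function_vimage_sets[OF X, of v] T(2) by simp
  then show "fibre_entropy M (\<lambda>x. X (T x)) = fibre_entropy M X"
    using fibre_entropy_eq_sum[OF XT simple_functionD(1)[OF X] sub]
      fibre_entropy_eq_sum[OF X simple_functionD(1)[OF X] order_refl] by simp
qed

end

section \<open>Subadditive sequences\<close>

text \<open>
  Fekete's lemma, for nonnegative sequences. The limit is the infimum \<open>L\<close> of the quotients: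
  if \<open>u m / m\<close> is close to \<open>L\<close>, division of \<open>n\<close> by \<open>m\<close> with remainder gives
  \<open>u n / n \<le> u m / m + C / n\<close>, where \<open>C\<close> dominates the values at all remainders.
\<close>

lemma subadditive_quotient_convergent:
  fixes u :: "nat \<Rightarrow> real"
  assumes nonneg: "\<And>n. 0 \<le> u n" and sub: "\<And>m n. u (m + n) \<le> u m + u n"
  shows "convergent (\<lambda>n. u n / real n)"
proof -
  define L where "L = (INF n\<in>{1..}. u n / real n)"
  have bdd: "bdd_below ((\<lambda>n. u n / real n) ` {1..})"
    using nonneg by (auto intro!: bdd_belowI[of _ 0])
  have "(\<lambda>n. u n / real n) \<longlonglongrightarrow> L"
  proof (rule LIMSEQ_I)
    fix e :: real assume e: "e > 0"
    have "\<exists>m\<in>{1..}. u m / real m < L + e / 2"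
      using cInf_lessD[of "(\<lambda>n. u n / real n) ` {1..}" "L + e / 2"] e by (auto simp: L_def)
    then obtain m where m: "m \<ge> 1" "u m / real m < L + e / 2" by auto
    (* One constant that bounds the values at all remainders modulo m. *)
    define C where "C = (\<Sum>r<m. u r)"
    have C: "u r \<le> C" if "r < m" for r
      unfolding C_def using that nonneg by (intro member_le_sum) auto
    have mult: "u (q * m + r) \<le> real q * u m + u r" for q r
    proof (induction q)
      case (Suc q)
      have "u (Suc q * m + r) \<le> u m + u (q * m + r)"
        using sub[of m "q * m + r"] by (simp add: algebra_simps)
      with Suc show ?case by (simp add: algebra_simps)
    qed simp
    have upper: "u n / real n \<le> u m / real m + C / real n" if n: "n \<ge> 1" for n
    proof -
      have "u n \<le> real (n div m) * u m + u (n mod m)" using mult[of "n div m" "n mod m"] by simp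
      also have "\<dots> \<le> real n / real m * u m + C"
      proof (intro add_mono mult_right_mono C)
        show "real (n div m) \<le> real n / real m" using m by (simp add: le_divide_eq flip: of_nat_mult)
      qed (use m nonneg in auto)
      finally have "u n / real n \<le> (real n / real m * u m + C) / real n"
        by (rule divide_right_mono) simp
      then show ?thesis using n by (simp add: add_divide_distrib)
    qed
    have "(\<lambda>n. C / real n) \<longlonglongrightarrow> 0" by (rule lim_const_over_n)
    then have "eventually (\<lambda>n. C / real n < e / 2) sequentially"
      by (rule order_tendstoD) (use e in simp)
    then obtain n0 where n0: "\<And>n. n \<ge> n0 \<Longrightarrow> C / real n < e / 2"
      by (auto simp: eventually_sequentially)
    have "norm (u n / real n - L) < e" if n: "n \<ge> max 1 n0" for n
    proof -
      have "L \<le> u n / real n" unfolding L_def using n by (intro cINF_lower bdd) auto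
      moreover have "C / real n < e / 2" using n0 n by simp
      with upper[of n] m n have "u n / real n < L + e" by linarith
      ultimately show ?thesis by simp
    qed
    then show "\<exists>no. \<forall>n\<ge>no. norm (u n / real n - L) < e" by blast
  qed
  then show ?thesis by (rule convergentI)
qed

section \<open>Itineraries and iterated joins\<close>

text \<open>
  Labels the cells of the join of the first \<open>n\<close> preimages of the partition labelled by
  \<open>c\<close>. Lists are used so that itineraries of all lengths have the same type.
\<close>

definition itinerary :: "('a \<Rightarrow> 'a) \<Rightarrow> ('a \<Rightarrow> 'b) \<Rightarrow> nat \<Rightarrow> 'a \<Rightarrow> 'b list" where
  "itinerary T c n x = map (\<lambda>i. c ((T ^^ i) x)) [0..<n]"

lemma itinerary_eq_iff:
  "itinerary T c n x = itinerary T c n y \<longleftrightarrow> (\<forall>i<n. c ((T ^^ i) x) = c ((T ^^ i) y))"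
  by (auto simp: itinerary_def)

lemma itinerary_Suc: "itinerary T c (Suc n) x = itinerary T c n x @ [c ((T ^^ n) x)]"
  by (simp add: itinerary_def)

lemma funpow_in_space:
  assumes "T \<in> space M \<rightarrow> space M" "x \<in> space M"
  shows "(T ^^ n) x \<in> space M"
  using assms by (induction n) auto

lemma partition_join_fibres:
  "partition_join (fibres M X) (fibres M Y) = fibres M (\<lambda>x. (X x, Y x))"
proof (intro equalityI subsetI)
  fix A assume "A \<in> partition_join (fibres M X) (fibres M Y)"
  then obtain a b z where A: "A = {y \<in> space M. X y = X a} \<inter> {y \<in> space M. Y y = Y b}" "z \<in> A"
    by (auto simp: partition_join_def fibres_def)
  then have "z \<in> space M" "A = {y \<in> space M. (X y, Y y) = (X z, Y z)}" by auto
  then show "A \<in> fibres M (\<lambda>x. (X x, Y x))" unfolding fibres_def by blast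
next
  fix A assume "A \<in> fibres M (\<lambda>x. (X x, Y x))"
  then obtain x where x: "x \<in> space M" "A = {y \<in> space M. (X y, Y y) = (X x, Y x)}"
    by (auto simp: fibres_def)
  then have "A = {y \<in> space M. X y = X x} \<inter> {y \<in> space M. Y y = Y x}" "A \<noteq> {}" by auto
  then show "A \<in> partition_join (fibres M X) (fibres M Y)"
    unfolding partition_join_def fibres_def using x(1) by blast
qed

lemma partition_vimage_fibres:
  assumes T: "T \<in> space M \<rightarrow> space M"
  shows "partition_vimage M T (fibres M X) = fibres M (\<lambda>x. X (T x))"
proof (intro equalityI subsetI)
  fix A assume "A \<in> partition_vimage M T (fibres M X)"
  then obtain a z where A: "A = T -` {y \<in> space M. X y = X a} \<inter> space M" "z \<in> A"
    by (auto simp: partition_vimage_def fibres_def)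
  then have "z \<in> space M" "A = {y \<in> space M. X (T y) = X (T z)}" using T by auto
  then show "A \<in> fibres M (\<lambda>x. X (T x))" unfolding fibres_def by blast
next
  fix A assume "A \<in> fibres M (\<lambda>x. X (T x))"
  then obtain x where x: "x \<in> space M" "A = {y \<in> space M. X (T y) = X (T x)}"
    by (auto simp: fibres_def)
  then have "A = T -` {y \<in> space M. X y = X (T x)} \<inter> space M" "A \<noteq> {}" "T x \<in> space M"
    using T by auto
  then show "A \<in> partition_vimage M T (fibres M X)"
    unfolding partition_vimage_def fibres_def by blast
qed

lemma iterated_join_fibres:
  assumes T: "T \<in> space M \<rightarrow> space M"
  shows "iterated_join M T (fibres M c) n = fibres M (itinerary T c n)"
proof (induction n)
  case 0
  show ?case by (auto simp: fibres_def itinerary_def)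
next
  case (Suc n)
  have "(T ^^ n) \<in> space M \<rightarrow> space M" using funpow_in_space[OF T] by auto
  then have "iterated_join M T (fibres M c) (Suc n) =
      fibres M (\<lambda>x. (itinerary T c n x, c ((T ^^ n) x)))"
    by (simp add: Suc partition_vimage_fibres partition_join_fibres)
  also have "\<dots> = fibres M (itinerary T c (Suc n))"
    by (rule fibres_cong) (simp add: itinerary_Suc)
  finally show ?case .
qed

lemma finite_measurable_partition_eq_fibres:
  assumes "finite_measurable_partition M P"
  obtains c :: "'a \<Rightarrow> 'a set" where "simple_function M c" "P = fibres M c"
proof
  have fin: "finite P" and sub: "P \<subseteq> sets M" and part: "partition_on (space M) P"
    using assms by (auto simp: finite_measurable_partition_def)
  define c where "c x = (THE A. A \<in> P \<and> x \<in> A)" for x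
  have c: "c x = A" if "A \<in> P" "x \<in> A" for x A
    unfolding c_def using part that
    by (intro the_equality) (auto simp: partition_on_def disjoint_def)
  have ex: "\<exists>A\<in>P. x \<in> A" if "x \<in> space M" for x
    using part that by (auto simp: partition_on_def)
  have fibre: "{y \<in> space M. c y = A} = A" if "A \<in> P" for A
    using c ex that sub[THEN subsetD, THEN sets.sets_into_space] by blast
  have img: "c ` space M = P"
  proof (intro equalityI subsetI)
    fix A assume "A \<in> P"
    moreover from this part obtain x where "x \<in> A" by (metis all_not_in_conv partition_on_def)
    ultimately show "A \<in> c ` space M"
      using c sub[THEN subsetD, THEN sets.sets_into_space] by blast
  qed (use c ex in force)
  show "simple_function M c"
    unfolding simple_function_def img
  proof (intro conjI ballI fin)
    fix A assume A: "A \<in> P"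
    have "c -` {A} \<inter> space M = {y \<in> space M. c y = A}" by auto
    then show "c -` {A} \<inter> space M \<in> sets M" using fibre[OF A] sub A by auto
  qed
  have "fibres M c = (\<lambda>A. {y \<in> space M. c y = A}) ` (c ` space M)" by (auto simp: fibres_def)
  then show "P = fibres M c" using img fibre by simp
qed

lemma fibres_finite_measurable_partition:
  assumes c: "simple_function M c"
  shows "finite_measurable_partition M (fibres M c)"
proof -
  have "fibres M c = (\<lambda>A. {y \<in> space M. c y = A}) ` (c ` space M)" by (auto simp: fibres_def)
  then have "finite (fibres M c)" "fibres M c \<subseteq> sets M"
    using simple_functionD(1)[OF c] simple_function_vimage_sets[OF c] by auto
  moreover have "partition_on (space M) (fibres M c)"
    by (auto simp: partition_on_def disjoint_def fibres_def)
  ultimately show ?thesis by (simp add: finite_measurable_partition_def)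
qed

section \<open>Conditional entropy given a generating sequence\<close>

text \<open>
  The function \<open>- t ln t\<close> vanishes at both ends of the unit interval, so up to a small error it
  is dominated by a multiple of \<open>t (1 - t)\<close>. The latter is quadratic and, as a conditional
  variance, is controlled by the measure of symmetric differences. Near \<open>0\<close> the bound
  \<open>- t ln t \<le> 2 sqrt t\<close> is used, away from \<open>0\<close> the bound \<open>- t ln t \<le> 1 - t\<close>.
\<close>

lemma neg_x_ln_x_bound:
  fixes e :: real
  assumes e: "e > 0"
  obtains K where "K > 0" "\<And>t. 0 \<le> t \<Longrightarrow> t \<le> 1 \<Longrightarrow> - t * ln t \<le> e + K * (t * (1 - t))"
proof
  (* The two bounds meet at t = (e / 2)^2: below it 2 sqrt t is at most e, above it (2 / e)^2 * t is at least 1. *)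
  show "(2 / e)\<^sup>2 > 0" using e by simp
  fix t :: real assume t: "0 \<le> t" "t \<le> 1"
  show "- t * ln t \<le> e + (2 / e)\<^sup>2 * (t * (1 - t))"
  proof (cases "t = 0")
    case False
    then have t0: "t > 0" using t by simp
    have ln: "- ln s \<le> 1 / s - 1" if "s > 0" for s :: real
      using ln_le_minus_one[of "1 / s"] that by (simp add: ln_div)
    show ?thesis
    proof (cases "t \<le> (e / 2)\<^sup>2")
      case True
      have "- t * ln t = 2 * t * (- ln (sqrt t))" using t0 by (simp add: ln_sqrt)
      also have "\<dots> \<le> 2 * t * (1 / sqrt t - 1)" using t0 by (intro mult_left_mono ln) auto
      also have "\<dots> \<le> 2 * (t / sqrt t)" using t0 by (simp add: algebra_simps)
      also have "t / sqrt t = sqrt t" using t0 by (simp add: real_div_sqrt)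
      also have "2 * sqrt t \<le> e" using real_sqrt_le_mono[OF True] e by simp
      finally show ?thesis using t e by (smt (verit) mult_nonneg_nonneg zero_le_power2)
    next
      case False
      have "- t * ln t = t * (- ln t)" by simp
      also have "\<dots> \<le> t * (1 / t - 1)" using t0 by (intro mult_left_mono ln) auto
      also have "\<dots> = 1 * (1 - t)" using t0 by (simp add: field_simps)
      also have "\<dots> \<le> ((2 / e)\<^sup>2 * t) * (1 - t)"
        using False e t by (intro mult_right_mono) (auto simp: field_simps power2_eq_square)
      finally show ?thesis using e by (simp add: mult.assoc)
    qed
  qed (use e in auto)
qed

text \<open>
  The sets that are approximable from the algebra form a \<open>\<sigma>\<close>-algebra: a countable union is
  close to a finite one by continuity from below, and finite unions of approximable sets are
  approximated piece by piece.
\<close>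

lemma (in finite_measure) algebra_approximation:
  assumes G: "algebra (space M) G" and gen: "sets M = sigma_sets (space M) G"
    and A: "A \<in> sets M" and e: "e > 0"
  shows "\<exists>B\<in>G. measure M (sym_diff A B) < e"
proof -
  interpret algebra "space M" G by fact
  have GM: "B \<in> sets M" if "B \<in> G" for B using that gen by auto
  define P where "P A \<longleftrightarrow> A \<in> sets M \<and> (\<forall>e>0. \<exists>B\<in>G. measure M (sym_diff A B) < e)" for A
  have Un: "P (A \<union> A')" if P: "P A" "P A'" for A A'
    unfolding P_def
  proof (intro conjI allI impI)
    show "A \<union> A' \<in> sets M" using P by (auto simp: P_def)
    fix e :: real assume "e > 0"
    then have "e / 2 > 0" by simp
    then obtain B B' where B: "B \<in> G" "B' \<in> G"
      "measure M (sym_diff A B) < e / 2" "measure M (sym_diff A' B') < e / 2"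
      using P unfolding P_def by metis
    have "measure M (sym_diff (A \<union> A') (B \<union> B')) \<le> measure M (sym_diff A B \<union> sym_diff A' B')"
      using P B GM by (intro finite_measure_mono) (auto simp: P_def)
    also have "\<dots> \<le> measure M (sym_diff A B) + measure M (sym_diff A' B')"
      using P B GM by (intro measure_Un_le) (auto simp: P_def)
    also have "\<dots> < e" using B by simp
    finally show "\<exists>B\<in>G. measure M (sym_diff (A \<union> A') B) < e" using B by blast
  qed
  have base: "P B" if "B \<in> G" for B
    unfolding P_def using that GM by (auto intro!: bexI[of _ B])
  have "P A"
    using A[unfolded gen]
  proof (induction rule: sigma_sets.induct)
    case (Basic a) then show ?case by (rule base)
  next
    case Empty show ?case by (rule base) simp
  next
    case (Compl a)
    have "sym_diff (space M - a) (space M - B) = sym_diff a B" if "B \<in> G" for B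
      using sets.sets_into_space[OF GM[OF that]] sets.sets_into_space[of a M] Compl by (auto simp: P_def)
    then show ?case using Compl unfolding P_def
      by (metis compl_sets sets.compl_sets)
  next
    case (Union a)
    let ?U = "\<lambda>n. \<Union>i<n. a i"
    have PU: "P (?U n)" for n
    proof (induction n)
      case 0 show ?case by (simp add: base)
    next
      case (Suc n) then show ?case using Un[OF Union(2)[of n]] by (simp add: lessThan_Suc)
    qed
    have am: "a i \<in> sets M" for i using Union by (auto simp: P_def)
    show ?case unfolding P_def
    proof (intro conjI allI impI)
      show UM: "(\<Union>i. a i) \<in> sets M" using am by auto
      fix e :: real assume e: "e > 0"
      have "(\<lambda>n. measure M (?U n)) \<longlonglongrightarrow> measure M (\<Union>n. ?U n)"
        using am by (intro finite_Lim_measure_incseq) (auto simp: incseq_def intro: less_le_trans)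
      also have "(\<Union>n. ?U n) = (\<Union>i. a i)" by auto
      finally have "eventually (\<lambda>n. measure M (?U n) > measure M (\<Union>i. a i) - e / 2) sequentially"
        by (rule order_tendstoD) (use e in simp)
      then obtain n where n: "measure M (?U n) > measure M (\<Union>i. a i) - e / 2"
        by (auto simp: eventually_sequentially)
      have "e / 2 > 0" using e by simp
      then obtain B where B: "B \<in> G" "measure M (sym_diff (?U n) B) < e / 2"
        using PU[of n] unfolding P_def by blast
      have "measure M (sym_diff (\<Union>i. a i) B) \<le> measure M (((\<Union>i. a i) - ?U n) \<union> sym_diff (?U n) B)"
        using am UM B GM by (intro finite_measure_mono) auto
      also have "\<dots> \<le> measure M ((\<Union>i. a i) - ?U n) + measure M (sym_diff (?U n) B)"
        using am UM B GM by (intro measure_Un_le) auto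
      also have "measure M ((\<Union>i. a i) - ?U n) = measure M (\<Union>i. a i) - measure M (?U n)"
        using am UM by (intro finite_measure_Diff) auto
      finally show "\<exists>B\<in>G. measure M (sym_diff (\<Union>i. a i) B) < e" using n B by force
    qed
  qed
  then show ?thesis using e by (auto simp: P_def)
qed

context prob_space
begin

lemma measure_eq_sum_fibres:
  assumes Z: "simple_function M Z" and S: "S \<in> sets M"
  shows "measure M S = (\<Sum>z\<in>Z ` space M. measure M {x \<in> S. Z x = z})"
proof -
  have *: "{x \<in> S. Z x = z} = S \<inter> {x \<in> space M. Z x = z}" for z
    using sets.sets_into_space[OF S] by auto
  have "measure M (\<Union>z\<in>Z ` space M. {x \<in> S. Z x = z}) = (\<Sum>z\<in>Z ` space M. measure M {x \<in> S. Z x = z})"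
    using simple_functionD(1)[OF Z] simple_function_vimage_sets[OF Z] S
    by (intro finite_measure_finite_Union) (auto simp: * disjoint_family_on_def)
  moreover have "(\<Union>z\<in>Z ` space M. {x \<in> S. Z x = z}) = S"
    using sets.sets_into_space[OF S] by auto
  ultimately show ?thesis by simp
qed

text \<open>
  If each level set of \<open>X\<close> is almost a union of level sets of \<open>Z\<close>, then \<open>Z\<close> leaves
  little uncertainty about \<open>X\<close>. With \<open>t\<close> the conditional probability of \<open>X = a\<close> on the
  cell \<open>Z = z\<close> of measure \<open>q\<close>, the cell contributes \<open>- q t ln t\<close>. The part
  \<open>q t (1 - t)\<close> is at most \<open>q t\<close> and at most \<open>q (1 - t)\<close>, and one of these two is the
  measure of the error made on this cell, whether or not \<open>z\<close> belongs to \<open>U a\<close>.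
\<close>

lemma conditional_entropy_le_approximation:
  assumes X: "simple_function M X" and Z: "simple_function M Z"
    and K: "K \<ge> 0" "\<And>t. 0 \<le> t \<Longrightarrow> t \<le> 1 \<Longrightarrow> - t * ln t \<le> e + K * (t * (1 - t))"
  shows "fibre_entropy M (\<lambda>x. (X x, Z x)) - fibre_entropy M Z \<le> real (card (X ` space M)) * e +
    K * (\<Sum>a\<in>X ` space M. measure M (sym_diff {x \<in> space M. X x = a} {x \<in> space M. Z x \<in> U a}))"
proof -
  note finX = simple_functionD(1)[OF X] and finZ = simple_functionD(1)[OF Z]
  note mX [measurable] = simple_function_vimage_sets[OF X]
  note mZ [measurable] = simple_function_vimage_sets[OF Z]
  have mU [measurable]: "{x \<in> space M. Z x \<in> V} \<in> sets M" for V
  proof -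
    have "{x \<in> space M. Z x \<in> V} = (\<Union>z\<in>Z ` space M \<inter> V. {x \<in> space M. Z x = z})" by auto
    then show ?thesis using finZ by (auto intro!: sets.finite_UN)
  qed
  define p where "p a z = measure M {x \<in> space M. X x = a \<and> Z x = z}" for a z
  define q where "q z = measure M {x \<in> space M. Z x = z}" for z
  define D where "D a = sym_diff {x \<in> space M. X x = a} {x \<in> space M. Z x \<in> U a}" for a
  have D [measurable]: "D a \<in> sets M" for a unfolding D_def by measurable
  have pm [measurable]: "{x \<in> space M. X x = a \<and> Z x = z} \<in> sets M" for a z by measurable
  have q_sum: "q z = (\<Sum>a\<in>X ` space M. p a z)" for z
    unfolding q_def p_def using measure_eq_sum_fibres[OF X mZ[of z]] by (simp add: conj_ac)
  have XZ: "simple_function M (\<lambda>x. (X x, Z x))" using X Z by (rule simple_function_Pair)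
  have "fibre_entropy M (\<lambda>x. (X x, Z x)) = - (\<Sum>v\<in>X ` space M \<times> Z ` space M.
      measure M {x \<in> space M. (X x, Z x) = v} * ln (measure M {x \<in> space M. (X x, Z x) = v}))"
    using finX finZ by (intro fibre_entropy_eq_sum[OF XZ]) auto
  also have "\<dots> = (\<Sum>a\<in>X ` space M. \<Sum>z\<in>Z ` space M. - p a z * ln (p a z))"
    by (simp add: sum.cartesian_product p_def case_prod_beta prod_eq_iff sum_negf)
  finally have eXZ: "fibre_entropy M (\<lambda>x. (X x, Z x)) = \<dots>" .
  have "fibre_entropy M Z = - (\<Sum>z\<in>Z ` space M. q z * ln (q z))"
    unfolding fibre_entropy_eq_sum[OF Z finZ order_refl] q_def ..
  also have "\<dots> = - (\<Sum>z\<in>Z ` space M. \<Sum>a\<in>X ` space M. p a z * ln (q z))"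
    by (subst (1) q_sum) (simp add: sum_distrib_right)
  also have "\<dots> = - (\<Sum>a\<in>X ` space M. \<Sum>z\<in>Z ` space M. p a z * ln (q z))"
    by (subst sum.swap) simp
  finally have "fibre_entropy M (\<lambda>x. (X x, Z x)) - fibre_entropy M Z =
      (\<Sum>a\<in>X ` space M. \<Sum>z\<in>Z ` space M. p a z * ln (q z) - p a z * ln (p a z))"
    unfolding eXZ by (simp add: sum_subtractf sum_negf)
  also have "\<dots> \<le> (\<Sum>a\<in>X ` space M. \<Sum>z\<in>Z ` space M. e * q z + K * measure M {x \<in> D a. Z x = z})"
  proof (intro sum_mono)
    fix a z
    have pq: "0 \<le> p a z" "p a z \<le> q z"
      unfolding p_def q_def by (auto intro!: finite_measure_mono)
    show "p a z * ln (q z) - p a z * ln (p a z) \<le> e * q z + K * measure M {x \<in> D a. Z x = z}"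
    proof (cases "p a z = 0")
      case True
      have "0 \<le> e" using K(2)[of 0] by simp
      then show ?thesis using True K(1) pq by simp
    next
      case False
      then have pos: "0 < p a z" "0 < q z" using pq by auto
      define t where "t = p a z / q z"
      have t: "0 < t" "t \<le> 1" using pos pq by (auto simp: t_def)
      have "p a z * ln (q z) - p a z * ln (p a z) = q z * (- t * ln t)"
        using pos by (simp add: t_def ln_div algebra_simps)
      also have "\<dots> \<le> q z * (e + K * (t * (1 - t)))"
        using K(2)[of t] t pos by (intro mult_left_mono) auto
      also have "\<dots> = e * q z + K * (p a z * (1 - t))"
        using pos by (simp add: t_def algebra_simps)
      also have "p a z * (1 - t) \<le> measure M {x \<in> D a. Z x = z}"
      proof (cases "z \<in> U a")
        case True
        have "p a z * (1 - t) \<le> q z * (1 - t)" using pq t by (intro mult_right_mono) auto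
        also have "\<dots> = q z - p a z" using pos by (simp add: t_def field_simps)
        also have "\<dots> = measure M ({x \<in> space M. Z x = z} - {x \<in> space M. X x = a \<and> Z x = z})"
          unfolding q_def p_def by (intro finite_measure_Diff[symmetric]) auto
        also have "{x \<in> space M. Z x = z} - {x \<in> space M. X x = a \<and> Z x = z} = {x \<in> D a. Z x = z}"
          using True by (auto simp: D_def)
        finally show ?thesis .
      next
        case False
        have "p a z * (1 - t) \<le> p a z * 1" using pq t by (intro mult_left_mono) auto
        also have "{x \<in> space M. X x = a \<and> Z x = z} = {x \<in> D a. Z x = z}"
          using False by (auto simp: D_def)
        then have "p a z * 1 = measure M {x \<in> D a. Z x = z}" by (simp add: p_def)
        finally show ?thesis .
      qed
      finally show ?thesis using K(1) by (simp add: mult_left_mono)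
    qed
  qed
  also have "\<dots> = (\<Sum>a\<in>X ` space M. e * (\<Sum>z\<in>Z ` space M. q z) + K * measure M (D a))"
    by (intro sum.cong refl)
      (simp add: sum.distrib sum_distrib_left measure_eq_sum_fibres[OF Z D])
  also have "(\<Sum>z\<in>Z ` space M. q z) = 1"
    using measure_eq_sum_fibres[OF Z sets.top] by (simp add: q_def prob_space)
  finally show ?thesis by (simp add: sum.distrib sum_distrib_left D_def)
qed

text \<open>
  The level sets of an increasing sequence of simple functions form an algebra, because two of them
  are level sets of the later function. Hence every level set of \<open>X\<close> is approximable, and
  finitely many of them are so by level sets of a single \<open>Z k\<close>.
\<close>

lemma conditional_entropy_generating_small:
  fixes Z :: "nat \<Rightarrow> 'a \<Rightarrow> 'b"
  assumes X: "simple_function M X" and Z: "\<And>k. simple_function M (Z k)"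
    and mono: "\<And>j k x y. j \<le> k \<Longrightarrow> x \<in> space M \<Longrightarrow> y \<in> space M \<Longrightarrow> Z k x = Z k y \<Longrightarrow> Z j x = Z j y"
    and gen: "sets M = sigma_sets (space M) {{x \<in> space M. Z k x \<in> U} | k U. True}"
    and e: "e > 0"
  shows "\<exists>k. fibre_entropy M (\<lambda>x. (X x, Z k x)) \<le> fibre_entropy M (Z k) + e"
proof -
  let ?G = "{{x \<in> space M. Z k x \<in> U} | k U. True}"
  define n where "n = real (card (X ` space M))"
  have n: "n > 0" using simple_functionD(1)[OF X] not_empty by (auto simp: n_def card_gt_0_iff)
  have lift: "\<exists>U'. {x \<in> space M. Z j x \<in> U} = {x \<in> space M. Z k x \<in> U'}" if "j \<le> k" for j k U
  proof (intro exI[of _ "Z k ` {x \<in> space M. Z j x \<in> U}"] set_eqI iffI)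
    fix x assume x: "x \<in> {x \<in> space M. Z k x \<in> Z k ` {x \<in> space M. Z j x \<in> U}}"
    then obtain y where "y \<in> space M" "Z j y \<in> U" "Z k x = Z k y" by blast
    then show "x \<in> {x \<in> space M. Z j x \<in> U}" using mono[OF that, of x y] x by simp
  qed blast
  have "algebra (space M) ?G"
    unfolding algebra_iff_Un
  proof (intro conjI ballI)
    show "?G \<subseteq> Pow (space M)" by auto
    have "{} = {x \<in> space M. Z 0 x \<in> {}}" by simp
    then show "{} \<in> ?G" by blast
    fix A assume "A \<in> ?G"
    then obtain k U where A: "A = {x \<in> space M. Z k x \<in> U}" by auto
    then have "space M - A = {x \<in> space M. Z k x \<in> - U}" by auto
    then show "space M - A \<in> ?G" by blast
    fix B assume "B \<in> ?G"
    then obtain j V where B: "B = {x \<in> space M. Z j x \<in> V}" by auto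
    obtain U' where U': "A = {x \<in> space M. Z (max j k) x \<in> U'}"
      using lift[of k "max j k" U] A by auto
    obtain V' where V': "B = {x \<in> space M. Z (max j k) x \<in> V'}"
      using lift[of j "max j k" V] B by auto
    have "A \<union> B = {x \<in> space M. Z (max j k) x \<in> U' \<union> V'}" using U' V' by auto
    then show "A \<union> B \<in> ?G" by blast
  qed
  note approx = algebra_approximation[OF this gen]
  obtain K where K: "K > 0" "\<And>t. 0 \<le> t \<Longrightarrow> t \<le> 1 \<Longrightarrow> - t * ln t \<le> e / (2 * n) + K * (t * (1 - t))"
    using neg_x_ln_x_bound[of "e / (2 * n)"] e n by auto
  (* The n level sets share the two error terms: n * e / (2 n) and K * n * d are both e / 2. *)
  define d where "d = e / (2 * n * K)"
  have d: "d > 0" using e n K by (simp add: d_def)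
  define close where "close a k U \<longleftrightarrow>
    measure M (sym_diff {x \<in> space M. X x = a} {x \<in> space M. Z k x \<in> U}) < d" for a k U
  have "\<exists>k U. close a k U" for a
    using approx[OF simple_function_vimage_sets[OF X] d, of a] unfolding close_def by blast
  then obtain k U where kU: "close a (k a) (U a)" for a
    by metis
  define m where "m = Max (k ` X ` space M)"
  have km: "k a \<le> m" if "a \<in> X ` space M" for a
    unfolding m_def using that simple_functionD(1)[OF X] by (intro Max_ge) auto
  have "\<exists>U'. close a m U'" if a: "a \<in> X ` space M" for a
    using lift[OF km[OF a], of "U a"] kU[of a] unfolding close_def by metis
  then obtain U' where U': "close a m (U' a)" if "a \<in> X ` space M" for a by metis
  have "fibre_entropy M (\<lambda>x. (X x, Z m x)) - fibre_entropy M (Z m) \<le> n * (e / (2 * n)) +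
    K * (\<Sum>a\<in>X ` space M. measure M (sym_diff {x \<in> space M. X x = a} {x \<in> space M. Z m x \<in> U' a}))"
    unfolding n_def
    by (rule conditional_entropy_le_approximation[OF X Z]) (use K n_def in auto)
  also have "\<dots> \<le> n * (e / (2 * n)) + K * (\<Sum>a\<in>X ` space M. d)"
    using K(1) U' by (intro add_left_mono mult_left_mono sum_mono) (auto simp: close_def less_imp_le)
  also have "\<dots> = e" using n K(1) by (simp add: d_def n_def[symmetric])
  finally show ?thesis by (intro exI[of _ m]) simp
qed

section \<open>The entropy of a generating partition\<close>

lemma measure_preserving_funpow:
  assumes T: "T \<in> measurable M M" "distr M M T = M"
  shows "(T ^^ n) \<in> measurable M M" and "distr M M (T ^^ n) = M"
proof (induction n)
  case (Suc n)
  show "(T ^^ Suc n) \<in> measurable M M" using Suc T by (simp add: measurable_comp)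
  show "distr M M (T ^^ Suc n) = M"
    using distr_distr[OF T(1) Suc(1)] Suc(2) T(2) by (simp add: comp_def)
qed (simp_all add: id_def distr_id)

lemma simple_function_itinerary:
  assumes T: "T \<in> measurable M M" "distr M M T = M" and f: "simple_function M f"
  shows "simple_function M (itinerary T f n)"
proof (induction n)
  case (Suc n)
  have "simple_function M (\<lambda>x. (itinerary T f n x, f ((T ^^ n) x)))"
    using Suc fibre_entropy_compose_measure_preserving(1)[OF f measure_preserving_funpow[OF T]]
    by (rule simple_function_Pair)
  from simple_function_compose[OF this, of "\<lambda>(l, s). l @ [s]"]
  show ?case by (simp add: comp_def itinerary_Suc[abs_def])
qed (simp add: itinerary_def)

text \<open>
  An itinerary of length \<open>m + n\<close> splits into one of length \<open>m\<close> and the itinerary of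
  length \<open>n\<close> of the \<open>m\<close>-th iterate, which has the same entropy as from time \<open>0\<close>.
\<close>

lemma fibre_entropy_itinerary_add_le:
  assumes T: "T \<in> measurable M M" "distr M M T = M" and f: "simple_function M f"
  shows "fibre_entropy M (itinerary T f (m + n)) \<le>
    fibre_entropy M (itinerary T f m) + fibre_entropy M (itinerary T f n)"
proof -
  have split: "(\<forall>i<m + n. P i) \<longleftrightarrow> (\<forall>i<m. P i) \<and> (\<forall>i<n. P (i + m))" for P
  proof (intro iffI conjI allI impI)
    fix i assume "(\<forall>i<m. P i) \<and> (\<forall>i<n. P (i + m))" "i < m + n"
    then show "P i" by (cases "i < m") (auto dest: spec[of _ "i - m"])
  qed auto
  have "fibres M (itinerary T f (m + n)) = fibres M (\<lambda>x. (itinerary T f m x, itinerary T f n ((T ^^ m) x)))"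
    by (rule fibres_cong) (simp add: itinerary_eq_iff split funpow_add)
  then show ?thesis
    using fibre_entropy_subadditive[OF simple_function_itinerary[OF T f, of m]
        fibre_entropy_compose_measure_preserving(1)[OF simple_function_itinerary[OF T f, of n]
          measure_preserving_funpow[OF T, of m]]]
      fibre_entropy_compose_measure_preserving(2)[OF simple_function_itinerary[OF T f, of n]
          measure_preserving_funpow[OF T, of m]] by simp
qed

text \<open>
  The entropy rate is given by the operator \<^term>\<open>lim\<close>, which carries information only when the
  limit exists; subadditivity guarantees this.
\<close>

lemma entropy_wrt_partition_LIMSEQ:
  assumes T: "T \<in> measurable M M" "distr M M T = M" and f: "simple_function M f"
  shows "(\<lambda>n. fibre_entropy M (itinerary T f n) / real n) \<longlonglongrightarrow> entropy_wrt_partition M T (fibres M f)"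
proof -
  have Tsp: "T \<in> space M \<rightarrow> space M" using measurable_space[OF T(1)] by auto
  have "convergent (\<lambda>n. fibre_entropy M (itinerary T f n) / real n)"
    using fibre_entropy_nonneg[OF prob_space_axioms] fibre_entropy_itinerary_add_le[OF T f]
    by (rule subadditive_quotient_convergent)
  then show ?thesis
    by (simp add: entropy_wrt_partition_def iterated_join_fibres[OF Tsp] convergent_LIMSEQ_iff)
qed

text \<open>
  Suppose that \<open>k\<close> steps of the \<open>c\<close>-itinerary leave uncertainty at most \<open>e\<close> about
  \<open>f\<close>. By invariance, the uncertainty about \<open>f\<close> at time \<open>n\<close> is at most \<open>e\<close> given the
  steps from \<open>n\<close> to \<open>n + k\<close>, and submodularity lets this remain true given the longer
  itinerary of length \<open>m\<close> and the past of \<open>f\<close>.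
\<close>

lemma fibre_entropy_itinerary_conditional_le:
  assumes T: "T \<in> measurable M M" "distr M M T = M"
    and f: "simple_function M f" and c: "simple_function M c"
    and k: "fibre_entropy M (\<lambda>x. (f x, itinerary T c k x)) \<le> fibre_entropy M (itinerary T c k) + e"
  shows "n + k \<le> m \<Longrightarrow> fibre_entropy M (\<lambda>x. (itinerary T f n x, itinerary T c m x))
    \<le> fibre_entropy M (itinerary T c m) + real n * e"
proof (induction n)
  case 0
  have "fibres M (\<lambda>x. (itinerary T f 0 x, itinerary T c m x)) = fibres M (itinerary T c m)"
    by (rule fibres_cong) (simp add: itinerary_def)
  then show ?case by simp
next
  case (Suc n)
  note simple = simple_function_itinerary[OF T]
  note shift = fibre_entropy_compose_measure_preserving[OF _ measure_preserving_funpow[OF T, of n]]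
  let ?X = "\<lambda>x. f ((T ^^ n) x)" and ?Z = "\<lambda>x. itinerary T c k ((T ^^ n) x)"
  let ?Y = "\<lambda>x. (itinerary T f n x, itinerary T c m x)"
  (* The steps from n to n + k belong to the itinerary of length m. *)
  have Z: "?Z x = ?Z y" if "itinerary T c m x = itinerary T c m y" for x y
  proof -
    have eq: "(T ^^ i) ((T ^^ n) z) = (T ^^ (i + n)) z" for i z by (simp add: funpow_add)
    show ?thesis using that Suc.prems unfolding itinerary_eq_iff eq by simp
  qed
  have sub: "fibre_entropy M (\<lambda>x. (?X x, ?Y x, ?Z x)) + fibre_entropy M ?Z
      \<le> fibre_entropy M (\<lambda>x. (?X x, ?Z x)) + fibre_entropy M (\<lambda>x. (?Y x, ?Z x))"
    by (intro fibre_entropy_submodular shift simple_function_Pair simple f c)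
  have e1: "fibres M (\<lambda>x. (?X x, ?Y x, ?Z x)) = fibres M (\<lambda>x. (itinerary T f (Suc n) x, itinerary T c m x))"
  proof (rule fibres_cong)
    fix x y
    show "(?X x, ?Y x, ?Z x) = (?X y, ?Y y, ?Z y) \<longleftrightarrow>
        (itinerary T f (Suc n) x, itinerary T c m x) = (itinerary T f (Suc n) y, itinerary T c m y)"
      using Z[of x y] by (auto simp: itinerary_Suc)
  qed
  have e2: "fibres M (\<lambda>x. (?Y x, ?Z x)) = fibres M ?Y"
  proof (rule fibres_cong)
    fix x y show "(?Y x, ?Z x) = (?Y y, ?Z y) \<longleftrightarrow> ?Y x = ?Y y"
      using Z[of x y] by auto
  qed
  have e3: "fibre_entropy M ?Z = fibre_entropy M (itinerary T c k)"
    by (rule shift(2)[OF simple[OF c]])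
  have e4: "fibre_entropy M (\<lambda>x. (?X x, ?Z x)) = fibre_entropy M (\<lambda>x. (f x, itinerary T c k x))"
    by (rule shift(2)[OF simple_function_Pair[OF f simple[OF c]]])
  have "fibre_entropy M (\<lambda>x. (itinerary T f n x, itinerary T c m x))
      \<le> fibre_entropy M (itinerary T c m) + real n * e"
    using Suc by simp
  then show ?case using sub k unfolding e1 e2 e3 e4 by (simp add: algebra_simps)
qed

text \<open>
  For a competing partition labelled by \<open>f\<close>, choose \<open>k\<close> such that \<open>k\<close> steps of the
  generator determine \<open>f\<close> up to entropy \<open>e\<close>. Then \<open>n\<close> steps of \<open>f\<close> have at most the
  entropy of \<open>n + k\<close> steps of \<open>c\<close> plus \<open>n e\<close>, and division by \<open>n\<close> shows that the
  rate of \<open>f\<close> exceeds that of \<open>c\<close> by at most \<open>e\<close>.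
\<close>

theorem kolmogorov_sinai_generator:
  assumes T: "T \<in> measurable M M" "distr M M T = M" and c: "simple_function M c"
    and gen: "sets M = sigma_sets (space M) {{x \<in> space M. itinerary T c k x \<in> U} | k U. True}"
  shows "metric_entropy M T = ereal (entropy_wrt_partition M T (fibres M c))"
proof -
  note simple = simple_function_itinerary[OF T]
  have mono: "itinerary T c j x = itinerary T c j y"
    if "j \<le> k" "itinerary T c k x = itinerary T c k y" for j k x y
    using that by (simp add: itinerary_eq_iff)
  have upper: "entropy_wrt_partition M T (fibres M f) \<le> entropy_wrt_partition M T (fibres M c)"
    if f: "simple_function M f" for f :: "'a \<Rightarrow> 'a set"
  proof (rule field_le_epsilon)
    fix e :: real assume e: "e > 0"
    let ?u = "\<lambda>n. fibre_entropy M (itinerary T c n)"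
    have "\<exists>k. fibre_entropy M (\<lambda>x. (f x, itinerary T c k x)) \<le> ?u k + e"
      using mono by (intro conditional_entropy_generating_small[OF f simple[OF c] _ gen e])
    then obtain k where k: "fibre_entropy M (\<lambda>x. (f x, itinerary T c k x)) \<le> ?u k + e" ..
    have "fibre_entropy M (itinerary T f n) / real n \<le> ?u n / real n + ?u k / real n + e" if "n \<ge> 1" for n
    proof -
      have "fibre_entropy M (itinerary T f n) \<le> fibre_entropy M (\<lambda>x. (itinerary T f n x, itinerary T c (n + k) x))"
        by (intro fibre_entropy_mono simple_function_Pair simple f c) auto
      also have "\<dots> \<le> ?u (n + k) + real n * e"
        by (rule fibre_entropy_itinerary_conditional_le[OF T f c k]) simp
      also have "?u (n + k) \<le> ?u n + ?u k" by (rule fibre_entropy_itinerary_add_le[OF T c])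
      finally show ?thesis using that by (simp add: field_simps)
    qed
    moreover have "(\<lambda>n. ?u n / real n + ?u k / real n + e) \<longlonglongrightarrow> entropy_wrt_partition M T (fibres M c) + 0 + e"
      by (intro tendsto_add entropy_wrt_partition_LIMSEQ[OF T c] lim_const_over_n tendsto_const)
    ultimately show "entropy_wrt_partition M T (fibres M f) \<le> entropy_wrt_partition M T (fibres M c) + e"
      using LIMSEQ_le[OF entropy_wrt_partition_LIMSEQ[OF T f]] by auto
  qed
  show ?thesis
    unfolding metric_entropy_def
  proof (rule SUP_eqI)
    fix P assume "P \<in> {P. finite_measurable_partition M P}"
    then obtain f :: "'a \<Rightarrow> 'a set" where "simple_function M f" "P = fibres M f"
      using finite_measurable_partition_eq_fibres by auto
    then show "ereal (entropy_wrt_partition M T P) \<le> ereal (entropy_wrt_partition M T (fibres M c))"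
      using upper by simp
  qed (use fibres_finite_measurable_partition[OF c] in blast)
qed

end

section \<open>A strong law of large numbers\<close>

text \<open>
  For bounded variables Hoeffding's inequality makes the probabilities of a deviation by \<open>e\<close>
  decay geometrically, so the Borel--Cantelli lemma excludes infinitely many deviations. The
  interval is enlarged from \<open>b\<close> to \<open>b + 1\<close> since the inequality asks for positive length.
\<close>

theorem (in prob_space) strong_law_bounded_iid:
  fixes X :: "nat \<Rightarrow> 'a \<Rightarrow> real"
  assumes indep: "indep_vars (\<lambda>_. borel) X UNIV"
    and distr: "\<And>i. distr M borel (X i) = distr M borel (X 0)"
    and bounded: "AE x in M. X 0 x \<in> {a..b}"
  shows "AE x in M. (\<lambda>n. (\<Sum>i<n. X i x) / real n) \<longlonglongrightarrow> expectation (X 0)"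
proof -
  define c where "c = b + 1"
  have "AE x in M. a \<le> b" using bounded by eventually_elim auto
  then have "a < c" by (auto simp: c_def)
  have X [measurable]: "X i \<in> borel_measurable M" for i
    using indep by (auto simp: indep_vars_def)
  let ?A = "\<lambda>n x. (\<Sum>i<n. X i x) / real n"
  have near: "AE x in M. eventually (\<lambda>n. \<bar>?A n x - expectation (X 0)\<bar> < e) sequentially" if e: "e > 0" for e
  proof -
    define E where "E n = {x \<in> space M. \<bar>?A n x - expectation (X 0)\<bar> \<ge> e}" for n
    have [measurable]: "E n \<in> sets M" for n unfolding E_def by measurable
    have bound: "measure M (E n) \<le> 2 * exp (- 2 * e\<^sup>2 / (c - a)\<^sup>2) ^ n" for n
    proof (cases "n = 0")
      case True
      then show ?thesis by (auto intro!: order_trans[OF prob_le_1])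
    next
      case False
      interpret Hoeffding_ineq_iid M "{..<n}" X "X 0" a c "expectation (X 0)"
      proof unfold_locales
        show "indep_vars (\<lambda>_. borel) X {..<n}" by (rule indep_vars_subset[OF indep]) auto
        show "AE x in M. X 0 x \<in> {a..c}" using bounded by eventually_elim (auto simp: c_def)
        show "distr M borel (X i) = distr M borel (X 0)" for i by (rule distr)
      qed auto
      have "measure M (E n) \<le> 2 * exp (- 2 * real n * e\<^sup>2 / (c - a)\<^sup>2)"
      proof -
        have "{..<n} \<noteq> {}" using False by auto
        from Hoeffding_ineq_abs_ge'[OF less_imp_le[OF e] \<open>a < c\<close> this] show ?thesis
          unfolding E_def card_lessThan .
      qed
      also have "exp (- 2 * real n * e\<^sup>2 / (c - a)\<^sup>2) = exp (- 2 * e\<^sup>2 / (c - a)\<^sup>2) ^ n"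
        by (simp flip: exp_of_nat_mult)
      finally show ?thesis .
    qed
    have "summable (\<lambda>n. measure M (E n))"
    proof (rule summable_comparison_test')
      show "summable (\<lambda>n. 2 * exp (- 2 * e\<^sup>2 / (c - a)\<^sup>2) ^ n)"
        using e \<open>a < c\<close> by (intro summable_mult summable_geometric) auto
    qed (use bound in auto)
    then have "AE x in M. eventually (\<lambda>n. x \<in> space M - E n) sequentially"
      by (intro borel_cantelli_AE1) (auto simp: less_top[symmetric])
    then show ?thesis
      by eventually_elim (auto elim!: eventually_mono simp: E_def)
  qed
  have "AE x in M. \<forall>k. eventually (\<lambda>n. \<bar>?A n x - expectation (X 0)\<bar> < 1 / real (Suc k)) sequentially"
    unfolding AE_all_countable by (intro allI near) simp
  then show ?thesis
  proof eventually_elim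
    case (elim x)
    show ?case
    proof (rule tendstoI)
      fix e :: real assume "e > 0"
      then obtain k where k: "1 / real (Suc k) < e" by (rule nat_approx_posE)
      show "eventually (\<lambda>n. dist (?A n x) (expectation (X 0)) < e) sequentially"
        using elim[rule_format, of k]
        by (rule eventually_mono) (use k in \<open>simp add: dist_real_def\<close>)
    qed
  qed
qed

section \<open>Balls in the sequence space\<close>

lemma seq_dist_le_power_iff: "seq_dist \<sigma> \<tau> \<le> (1 / 2) ^ m \<longleftrightarrow> (\<forall>i<m. \<sigma> i = \<tau> i)"
proof (cases "\<sigma> = \<tau>")
  case False
  define I where "I = (LEAST i. \<sigma> i \<noteq> \<tau> i)"
  have "\<exists>i. \<sigma> i \<noteq> \<tau> i" using False by auto
  then have I: "\<sigma> I \<noteq> \<tau> I" unfolding I_def by (rule LeastI_ex)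
  have less: "\<sigma> i = \<tau> i" if "i < I" for i using not_less_Least[of i] that by (auto simp: I_def)
  have "seq_dist \<sigma> \<tau> \<le> (1 / 2) ^ m \<longleftrightarrow> m \<le> I"
    using False by (simp add: seq_dist_def I_def[symmetric] power_decreasing_iff)
  also have "\<dots> \<longleftrightarrow> (\<forall>i<m. \<sigma> i = \<tau> i)"
    using I less by (meson le_less_linear less_le_trans)
  finally show ?thesis .
qed (simp add: seq_dist_def)

lemma seq_dist_cases: "seq_dist \<sigma> \<tau> = 0 \<or> (\<exists>i. seq_dist \<sigma> \<tau> = (1 / 2) ^ i)"
  by (auto simp: seq_dist_def)

text \<open>
  The distance takes only the values \<open>0\<close> and \<open>2\<^sup>-\<^sup>i\<close>, so that a ball of any
  radius coincides with the closed ball whose radius is the largest power below it. Every ball is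
  thus a cylinder; the next lemma gives the converse.
\<close>

lemma seq_dist_ball_eq_cylinder:
  assumes "\<epsilon> > 0"
  obtains m where "\<And>\<sigma> \<tau>. seq_dist \<sigma> \<tau> < \<epsilon> \<longleftrightarrow> (\<forall>i<m. \<sigma> i = \<tau> i)"
proof -
  define m where "m = (LEAST i. (1 / 2) ^ i < \<epsilon>)"
  have "\<exists>i. (1 / 2) ^ i < \<epsilon>" using assms by (intro real_arch_pow_inv) auto
  then have m: "(1 / 2) ^ m < \<epsilon>" unfolding m_def by (rule LeastI_ex)
  have "seq_dist \<sigma> \<tau> \<le> (1 / 2) ^ m" if "seq_dist \<sigma> \<tau> < \<epsilon>" for \<sigma> \<tau> :: "nat \<Rightarrow> 'a"
    using seq_dist_cases[of \<sigma> \<tau>]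
  proof
    assume "\<exists>i. seq_dist \<sigma> \<tau> = (1 / 2) ^ i"
    then obtain i where i: "seq_dist \<sigma> \<tau> = (1 / 2) ^ i" by auto
    then have "m \<le> i" unfolding m_def using that by (intro Least_le) simp
    then show ?thesis unfolding i by (intro power_decreasing) auto
  qed simp
  then have "seq_dist \<sigma> \<tau> < \<epsilon> \<longleftrightarrow> (\<forall>i<m. \<sigma> i = \<tau> i)" for \<sigma> \<tau> :: "nat \<Rightarrow> 'a"
    using m by (auto simp flip: seq_dist_le_power_iff)
  then show ?thesis by (rule that)
qed

lemma cylinder_eq_seq_dist_ball:
  "seq_dist \<sigma> \<tau> < 2 * (1 / 2) ^ m \<longleftrightarrow> (\<forall>i<m. \<sigma> i = \<tau> i)"
proof -
  have "seq_dist \<sigma> \<tau> < 2 * (1 / 2) ^ m \<longleftrightarrow> seq_dist \<sigma> \<tau> \<le> (1 / 2) ^ m"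
  proof
    assume *: "seq_dist \<sigma> \<tau> < 2 * (1 / 2) ^ m"
    show "seq_dist \<sigma> \<tau> \<le> (1 / 2) ^ m" using seq_dist_cases[of \<sigma> \<tau>]
    proof
      assume "\<exists>i. seq_dist \<sigma> \<tau> = (1 / 2) ^ i"
      then obtain i where i: "seq_dist \<sigma> \<tau> = (1 / 2) ^ i" by auto
      have "(1 / 2 :: real) ^ Suc i < (1 / 2) ^ m" using * by (simp add: i)
      then have "m < Suc i" by (subst (asm) power_strict_decreasing_iff) auto
      then show ?thesis unfolding i by (intro power_decreasing) auto
    qed simp
  next
    assume "seq_dist \<sigma> \<tau> \<le> (1 / 2) ^ m"
    also have "(1 / 2 :: real) ^ m < 2 * (1 / 2) ^ m" by simp
    finally show "seq_dist \<sigma> \<tau> < 2 * (1 / 2) ^ m" .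
  qed
  then show ?thesis by (simp add: seq_dist_le_power_iff)
qed

lemma seq_shift_funpow: "(seq_shift ^^ n) \<sigma> i = \<sigma> (n + i)"
  by (induction n arbitrary: i) (auto simp: seq_shift_def)

section \<open>The entropy of the Bernoulli shift\<close>

locale bernoulli_scheme = L: prob_space L for L :: "'s measure" +
  fixes S :: "'s set"
  assumes finite_S: "finite S" and card_S: "card S \<ge> 2"
    and sets_L: "sets L = Pow S"
    and positive: "\<And>s. s \<in> S \<Longrightarrow> measure L {s} > 0"
begin

definition B :: "(nat \<Rightarrow> 's) measure" where "B = bernoulli_measure L"

definition information :: "'s \<Rightarrow> real" where "information s = - ln (measure L {s})"

definition letter_entropy :: real where
  "letter_entropy = (\<Sum>s\<in>S. measure L {s} * information s)"

lemma space_L: "space L = S"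
  using sets_eq_imp_space_eq[of L "count_space S"] sets_L by simp

lemma B_eq: "B = PiM UNIV (\<lambda>_. L)"
  by (simp add: B_def bernoulli_measure_def)

sublocale P: product_prob_space "\<lambda>_. L" "UNIV :: nat set" ..

sublocale B: prob_space B
  unfolding B_eq by (rule P.prob_space_axioms)

lemma space_B: "space B = {\<sigma>. \<forall>i. \<sigma> i \<in> S}"
  by (auto simp: B_eq space_PiM space_L PiE_def Pi_def)

lemma coordinate_measurable [measurable]: "(\<lambda>\<sigma>. \<sigma> i) \<in> measurable B L"
  unfolding B_eq by measurable

lemma pred_coordinate [measurable]: "Measurable.pred B (\<lambda>\<sigma>. \<sigma> i = s)"
proof -
  have "{\<sigma> \<in> space B. \<sigma> i = s} = (\<lambda>\<sigma>. \<sigma> i) -` ({s} \<inter> S) \<inter> space B"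
    by (auto simp: space_B)
  then have "{\<sigma> \<in> space B. \<sigma> i = s} \<in> sets B"
    using measurable_sets[OF coordinate_measurable, of "{s} \<inter> S" i] by (simp add: sets_L)
  then show ?thesis by (simp add: pred_def)
qed

lemma measure_le_1_strict:
  assumes "s \<in> S"
  shows "measure L {s} < 1"
proof -
  have "\<not> S \<subseteq> {s}" using card_S card_mono[of "{s}" S] by auto
  then obtain t where t: "t \<in> S" "t \<noteq> s" by auto
  have "measure L {s} + measure L {t} = measure L {s, t}"
    using L.finite_measure_Union[of "{s}" "{t}"] t assms by (simp add: sets_L insert_commute)
  also have "\<dots> \<le> 1" by simp
  finally show ?thesis using positive[OF t(1)] by simp
qed

lemma information_pos: "s \<in> S \<Longrightarrow> information s > 0"
  using positive measure_le_1_strict by (simp add: information_def)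

lemma letter_entropy_pos: "letter_entropy > 0"
  unfolding letter_entropy_def
  using finite_S card_S positive information_pos by (intro sum_pos) auto

lemma measure_cylinder:
  assumes \<sigma>: "\<sigma> \<in> space B"
  shows "measure B {\<tau> \<in> space B. \<forall>i<m. \<tau> i = \<sigma> i} = (\<Prod>i<m. measure L {\<sigma> i})"
proof -
  have "emeasure B {\<tau> \<in> space B. \<forall>i\<in>{..<m}. \<tau> i \<in> {\<sigma> i}} = (\<Prod>i<m. emeasure L {\<sigma> i})"
    using \<sigma> unfolding B_eq
    by (intro P.emeasure_PiM_Collect) (auto simp: sets_L space_B simp flip: B_eq)
  then have "ennreal (measure B {\<tau> \<in> space B. \<forall>i<m. \<tau> i = \<sigma> i}) = ennreal (\<Prod>i<m. measure L {\<sigma> i})"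
    by (simp add: B.emeasure_eq_measure L.emeasure_eq_measure prod_ennreal Ball_def)
  then show ?thesis by (simp add: prod_nonneg)
qed

text \<open>
  The information content of a cylinder is the sum of those of its letters. This single identity
  computes the entropy of the shift and describes the measures of balls.
\<close>

lemma ln_measure_cylinder:
  assumes \<sigma>: "\<sigma> \<in> space B"
  shows "- ln (measure B {\<tau> \<in> space B. \<forall>i<m. \<tau> i = \<sigma> i}) = (\<Sum>i<m. information (\<sigma> i))"
proof -
  have "measure L {\<sigma> i} \<noteq> 0" for i using \<sigma> positive[of "\<sigma> i"] by (auto simp: space_B)
  then show ?thesis
    unfolding measure_cylinder[OF \<sigma>] by (subst ln_prod) (auto simp: information_def sum_negf)
qed

lemma shift_measurable: "seq_shift \<in> measurable B B"
  unfolding seq_shift_def[abs_def] B_eq by (rule measurable_abs_UNIV) measurable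

lemma distr_shift: "distr B B seq_shift = B"
  using distr_PiM_reindex[of UNIV "\<lambda>_. L" Suc "UNIV :: nat set"] L.prob_space_axioms
  by (simp add: B_eq seq_shift_def[abs_def] restrict_UNIV)

lemma distr_coordinate: "distr B L (\<lambda>\<sigma>. \<sigma> i) = L"
  unfolding B_eq using P.PiM_component[of i] by simp

lemma information_measurable [measurable]: "information \<in> borel_measurable L"
  by (simp add: measurable_def sets_L space_L) 

lemma expectation_information: "B.expectation (\<lambda>\<sigma>. information (\<sigma> i)) = letter_entropy"
proof -
  have "B.expectation (\<lambda>\<sigma>. information (\<sigma> i)) = (\<integral>s. information s \<partial>distr B L (\<lambda>\<sigma>. \<sigma> i))"
    by (subst integral_distr) auto
  also have "\<dots> = (\<integral>s. information s \<partial>L)" by (simp add: distr_coordinate)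
  also have "\<dots> = (\<Sum>s\<in>(\<lambda>s. s) ` space L. measure L {t \<in> space L. t = s} * information s)"
  proof (rule L.sum_simple_function_eq_expectation[symmetric])
    show "simple_function L (\<lambda>s. s)"
      using finite_S by (auto simp: simple_function_def space_L sets_L)
  qed
  also have "\<dots> = letter_entropy"
    unfolding letter_entropy_def space_L by (intro sum.cong) (auto intro!: arg_cong[where f = "measure L"])
  finally show ?thesis .
qed

lemma information_bounded: "s \<in> S \<Longrightarrow> information s \<le> (\<Sum>s\<in>S. information s)"
  using finite_S information_pos by (intro member_le_sum) (auto simp: less_imp_le)

lemma integrable_information: "integrable B (\<lambda>\<sigma>. information (\<sigma> i))"
proof (rule B.integrable_const_bound[of _ "\<Sum>s\<in>S. information s"])
  show "AE \<sigma> in B. norm (information (\<sigma> i)) \<le> (\<Sum>s\<in>S. information s)"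
    using information_bounded information_pos
    by (auto intro!: AE_I2 simp: space_B abs_of_pos)
qed measurable

text \<open>
  The asymptotic equipartition property, here the strong law for the independent, identically
  distributed information contents of the letters.
\<close>

lemma information_equipartition:
  "AE \<sigma> in B. (\<lambda>n. (\<Sum>i<n. information (\<sigma> i)) / real n) \<longlonglongrightarrow> letter_entropy"
proof -
  have "B.indep_vars (\<lambda>_. L) (\<lambda>i \<sigma>. \<sigma> i) (UNIV :: nat set)"
    by (subst B.indep_vars_iff_distr_eq_PiM)
       (auto simp: distr_coordinate restrict_UNIV simp flip: B_eq)
  then have "B.indep_vars (\<lambda>_. borel) (\<lambda>i \<sigma>. information (\<sigma> i)) (UNIV :: nat set)"
    by (rule B.indep_vars_compose2) auto
  then have "AE \<sigma> in B. (\<lambda>n. (\<Sum>i<n. information (\<sigma> i)) / real n) \<longlonglongrightarrow>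
      B.expectation (\<lambda>\<sigma>. information (\<sigma> 0))"
  proof (rule B.strong_law_bounded_iid)
    have "distr B borel (\<lambda>\<sigma>. information (\<sigma> i)) = distr L borel information" for i
      using distr_distr[OF information_measurable coordinate_measurable[of i]]
      by (simp add: distr_coordinate comp_def)
    then show "distr B borel (\<lambda>\<sigma>. information (\<sigma> i)) = distr B borel (\<lambda>\<sigma>. information (\<sigma> 0))" for i
      by simp
    show "AE \<sigma> in B. information (\<sigma> 0) \<in> {0..\<Sum>s\<in>S. information s}"
      using information_bounded information_pos
      by (auto intro!: AE_I2 simp: space_B less_imp_le)
  qed
  then show ?thesis by (simp add: expectation_information)
qed

lemma simple_function_coordinate: "simple_function B (\<lambda>\<sigma>. \<sigma> 0)"
  unfolding simple_function_def
proof (intro conjI ballI)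
  show "finite ((\<lambda>\<sigma>. \<sigma> 0) ` space B)"
    by (rule finite_subset[OF _ finite_S]) (use space_B in blast)
  fix s
  have "(\<lambda>\<sigma>. \<sigma> 0) -` {s} \<inter> space B = {\<sigma> \<in> space B. \<sigma> 0 = s}" by auto
  then show "(\<lambda>\<sigma>. \<sigma> 0) -` {s} \<inter> space B \<in> sets B" by simp
qed

lemma itinerary_shift: "itinerary seq_shift (\<lambda>\<sigma>. \<sigma> 0) n \<sigma> = map \<sigma> [0..<n]"
  by (simp add: itinerary_def seq_shift_funpow)

text \<open>
  The fibres of the itinerary are cylinders, and the mean information content of a cylinder of
  length \<open>n\<close> is \<open>n\<close> times that of a letter.
\<close>

lemma fibre_entropy_coordinates:
  "fibre_entropy B (itinerary seq_shift (\<lambda>\<sigma>. \<sigma> 0) n) = real n * letter_entropy"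
proof -
  let ?F = "itinerary seq_shift (\<lambda>\<sigma>. \<sigma> 0) n"
  have "fibre_entropy B ?F = B.expectation (\<lambda>\<sigma>. - ln (measure B {\<tau> \<in> space B. ?F \<tau> = ?F \<sigma>}))"
    by (intro B.fibre_entropy_eq_expectation B.simple_function_itinerary
        shift_measurable distr_shift simple_function_coordinate)
  also have "\<dots> = B.expectation (\<lambda>\<sigma>. \<Sum>i<n. information (\<sigma> i))"
    by (intro Bochner_Integration.integral_cong refl)
       (simp add: itinerary_eq_iff seq_shift_funpow ln_measure_cylinder)
  also have "\<dots> = real n * letter_entropy"
    by (subst Bochner_Integration.integral_sum) (auto simp: integrable_information expectation_information)
  finally show ?thesis .
qed

lemma sets_B_generated:
  "sets B = sigma_sets (space B) {{\<sigma> \<in> space B. itinerary seq_shift (\<lambda>\<sigma>. \<sigma> 0) k \<sigma> \<in> U} | k U. True}"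
  (is "_ = sigma_sets _ ?G")
proof
  have "{f \<in> space B. f i \<in> A} \<in> ?G" for i A
  proof -
    have "{f \<in> space B. f i \<in> A} = {f \<in> space B. itinerary seq_shift (\<lambda>\<sigma>. \<sigma> 0) (Suc i) f \<in> {l. l ! i \<in> A}}"
      by (auto simp: itinerary_shift simp del: upt_Suc)
    then show ?thesis by blast
  qed
  then have gen: "{{f \<in> space B. f i \<in> A} | i A. i \<in> UNIV \<and> A \<in> sets L} \<subseteq> ?G" by blast
  have "sets B = sigma_sets (space B) {{f \<in> space B. f i \<in> A} | i A. i \<in> UNIV \<and> A \<in> sets L}"
    by (simp add: B_eq sets_PiM_single space_PiM)
  also have "\<dots> \<subseteq> sigma_sets (space B) ?G"
    by (rule sigma_sets_mono'[OF gen])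
  finally show "sets B \<subseteq> sigma_sets (space B) ?G" .
  show "sigma_sets (space B) ?G \<subseteq> sets B"
  proof (rule sets.sigma_sets_subset, safe)
    fix k :: nat and U :: "'s list set"
    have "{\<sigma> \<in> space B. itinerary seq_shift (\<lambda>\<sigma>. \<sigma> 0) k \<sigma> \<in> U} =
        itinerary seq_shift (\<lambda>\<sigma>. \<sigma> 0) k -` U \<inter> space B" by auto
    then show "{\<sigma> \<in> space B. itinerary seq_shift (\<lambda>\<sigma>. \<sigma> 0) k \<sigma> \<in> U} \<in> sets B"
      using simple_functionD(2)[OF B.simple_function_itinerary[OF shift_measurable distr_shift
          simple_function_coordinate]] by simp
  qed
qed

theorem metric_entropy_shift: "metric_entropy B seq_shift = ereal letter_entropy"
proof -
  let ?c = "\<lambda>\<sigma> :: nat \<Rightarrow> 's. \<sigma> 0"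
  have "(\<lambda>n. real n * letter_entropy / real n) \<longlonglongrightarrow> entropy_wrt_partition B seq_shift (fibres B ?c)"
    using B.entropy_wrt_partition_LIMSEQ[OF shift_measurable distr_shift simple_function_coordinate]
    by (simp only: fibre_entropy_coordinates)
  moreover have "(\<lambda>n. real n * letter_entropy / real n) \<longlonglongrightarrow> letter_entropy"
    by (rule tendsto_eventually, rule eventually_sequentiallyI[of 1]) simp
  ultimately have "entropy_wrt_partition B seq_shift (fibres B ?c) = letter_entropy"
    by (rule LIMSEQ_unique)
  then show ?thesis
    using B.kolmogorov_sinai_generator[OF shift_measurable distr_shift simple_function_coordinate
        sets_B_generated] by simp
qed

section \<open>The minimal asymptotic rate\<close>

lemma mball_seq_dist:
  assumes "\<sigma> \<in> space B"
  shows "Metric_space.mball (space B) seq_dist \<sigma> \<epsilon> = {\<tau> \<in> space B. seq_dist \<sigma> \<tau> < \<epsilon>}"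
proof -
  interpret Metric_space "space B" seq_dist by (rule Metric_space_seq_dist)
  show ?thesis using assms by (auto simp: in_mball)
qed

text \<open>
  A point of the cylinder of length \<open>m\<close> about \<open>\<sigma>\<close> agrees with \<open>\<sigma>\<close> up to time
  \<open>m\<close>, so it can be separated by more than \<open>\<delta> > 2\<^sup>-\<^sup>r\<close> only after \<open>m - r\<close> steps.
  Hence \<open>m - r\<close> is at most \<open>a\<close> times the information content of the cylinder. Dividing by
  \<open>m\<close> gives \<open>1 \<le> a h\<close> in the limit, where \<open>h\<close> is the entropy of a letter.
\<close>

lemma rate_lower_bound:
  assumes \<sigma>: "\<sigma> \<in> space B"
    and lim: "(\<lambda>n. (\<Sum>i<n. information (\<sigma> i)) / real n) \<longlonglongrightarrow> letter_entropy"
    and pair: "sensitivity_pair B seq_dist seq_shift \<sigma> \<delta> a"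
  shows "1 / letter_entropy \<le> a"
proof -
  let ?I = "\<lambda>m. \<Sum>i<m. information (\<sigma> i)"
  have "\<delta> > 0" using pair by (simp add: sensitivity_pair_def)
  then obtain r where r: "(1 / 2) ^ r < \<delta>" using real_arch_pow_inv[of \<delta> "1 / 2"] by auto
  have "real m - real r \<le> a * ?I m" for m
  proof -
    define ball where "ball = Metric_space.mball (space B) seq_dist \<sigma> (2 * (1 / 2) ^ m)"
    have ball: "ball = {\<tau> \<in> space B. \<forall>i<m. \<tau> i = \<sigma> i}"
      unfolding ball_def mball_seq_dist[OF \<sigma>] cylinder_eq_seq_dist_ball by auto
    have "2 * (1 / 2 :: real) ^ m > 0" by simp
    then obtain n where n: "real n \<le> - a * ln (measure B ball)"
      "measure B {\<tau> \<in> ball. seq_dist ((seq_shift ^^ n) \<sigma>) ((seq_shift ^^ n) \<tau>) > \<delta>} > 0"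
      using pair unfolding sensitivity_pair_def ball_def by blast
    have "{\<tau> \<in> ball. seq_dist ((seq_shift ^^ n) \<sigma>) ((seq_shift ^^ n) \<tau>) > \<delta>} \<noteq> {}"
      using n(2) by (metis less_irrefl measure_empty)
    then obtain \<tau> where \<tau>: "\<tau> \<in> ball" "seq_dist ((seq_shift ^^ n) \<sigma>) ((seq_shift ^^ n) \<tau>) > \<delta>" by auto
    then have "\<not> seq_dist ((seq_shift ^^ n) \<sigma>) ((seq_shift ^^ n) \<tau>) \<le> (1 / 2) ^ r" using r by simp
    then obtain i where i: "i < r" "\<sigma> (n + i) \<noteq> \<tau> (n + i)"
      by (auto simp: seq_dist_le_power_iff seq_shift_funpow)
    have "\<not> n + i < m" using i(2) \<tau>(1) by (auto simp: ball)
    then have "real m - real r \<le> real n" using i(1) by simp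
    also have "\<dots> \<le> a * - ln (measure B ball)" using n(1) by simp
    also have "\<dots> = a * ?I m" unfolding ball ln_measure_cylinder[OF \<sigma>] ..
    finally show ?thesis .
  qed
  then have le: "1 - real r / real m \<le> a * (?I m / real m)" if "m \<ge> 1" for m
    using divide_right_mono[of "real m - real r" "a * ?I m" "real m"] that
    by (simp add: diff_divide_distrib)
  have "(\<lambda>m. 1 - real r / real m) \<longlonglongrightarrow> 1 - 0"
    by (intro tendsto_diff tendsto_const lim_const_over_n)
  moreover have "(\<lambda>m. a * (?I m / real m)) \<longlonglongrightarrow> a * letter_entropy"
    by (intro tendsto_mult tendsto_const lim)
  ultimately have "1 - 0 \<le> a * letter_entropy"
    by (rule LIMSEQ_le) (use le in blast)
  then show ?thesis using letter_entropy_pos by (simp add: field_simps)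
qed

text \<open>
  If \<open>a h > 1\<close>, with \<open>h\<close> the entropy of a letter, then for all \<open>m \<ge> m0\<close> the cylinder of
  length \<open>m\<close> allows a waiting time of \<open>m\<close>. At that time the free coordinate \<open>m\<close> has
  become the first one, and a different letter there separates the orbits by distance \<open>1\<close>. For the
  finitely many \<open>m < m0\<close> no waiting is needed, since a difference in coordinate \<open>m\<close> is already a
  distance of at least \<open>2\<^sup>-\<^sup>m > \<delta>\<close>. Changing the letter in coordinate \<open>m\<close> gives a
  whole cylinder of such points, hence positive measure.
\<close>

lemma rate_upper_bound:
  assumes \<sigma>: "\<sigma> \<in> space B"
    and lim: "(\<lambda>n. (\<Sum>i<n. information (\<sigma> i)) / real n) \<longlonglongrightarrow> letter_entropy"
    and a: "1 / letter_entropy < a"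
  shows "\<exists>\<delta>>0. sensitivity_pair B seq_dist seq_shift \<sigma> \<delta> a"
proof -
  let ?I = "\<lambda>m. \<Sum>i<m. information (\<sigma> i)"
  have "0 < 1 / letter_entropy" using letter_entropy_pos by simp
  then have a0: "a > 0" using a by linarith
  have "1 / a < letter_entropy" using a a0 letter_entropy_pos by (simp add: field_simps)
  with lim have "eventually (\<lambda>m. 1 / a < ?I m / real m) sequentially" by (rule order_tendstoD)
  then obtain m0 where m0: "\<And>m. m \<ge> m0 \<Longrightarrow> 1 / a < ?I m / real m"
    by (auto simp: eventually_sequentially)
  have large: "real m \<le> a * ?I m" if "m \<ge> m0" for m
    using m0[OF that] a0 by (cases "m = 0") (auto simp: field_simps)
  have small: "0 \<le> a * ?I m" for m
    using \<sigma> a0 information_pos by (auto simp: space_B less_imp_le intro!: mult_nonneg_nonneg sum_nonneg)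
  (* The exponent exceeds m0, so that a difference in any coordinate up to m0 counts. *)
  define \<delta> :: real where "\<delta> = (1 / 2) ^ Suc m0"
  have "sensitivity_pair B seq_dist seq_shift \<sigma> \<delta> a"
    unfolding sensitivity_pair_def
  proof (intro conjI allI impI)
    fix \<epsilon> :: real assume "\<epsilon> > 0"
    then obtain m where m: "\<And>\<sigma> \<tau> :: nat \<Rightarrow> 's. seq_dist \<sigma> \<tau> < \<epsilon> \<longleftrightarrow> (\<forall>i<m. \<sigma> i = \<tau> i)"
      using seq_dist_ball_eq_cylinder by metis
    define ball where "ball = Metric_space.mball (space B) seq_dist \<sigma> \<epsilon>"
    have ball: "ball = {\<tau> \<in> space B. \<forall>i<m. \<tau> i = \<sigma> i}"
      unfolding ball_def mball_seq_dist[OF \<sigma>] m by auto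
    define n where "n = (if m \<ge> m0 then m else 0)"
    have "a * - ln (measure B ball) = a * ?I m" unfolding ball ln_measure_cylinder[OF \<sigma>] ..
    then have "real n \<le> - a * ln (measure B ball)"
      using large[of m] small[of m] by (simp add: n_def)
    moreover have "measure B {\<tau> \<in> ball. seq_dist ((seq_shift ^^ n) \<sigma>) ((seq_shift ^^ n) \<tau>) > \<delta>} > 0"
    proof -
      have "\<not> S \<subseteq> {\<sigma> m}" using card_S card_mono[of "{\<sigma> m}" S] by auto
      then obtain t where t: "t \<in> S" "t \<noteq> \<sigma> m" by auto
      define \<rho> where "\<rho> = \<sigma>(m := t)"
      have \<rho>: "\<rho> \<in> space B" using \<sigma> t by (auto simp: space_B \<rho>_def)
      have eq: "{\<tau> \<in> ball. seq_dist ((seq_shift ^^ n) \<sigma>) ((seq_shift ^^ n) \<tau>) > \<delta>} =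
          {\<tau> \<in> space B. (\<forall>i<m. \<tau> i = \<sigma> i) \<and> (\<exists>i<Suc m0. \<not> \<tau> (n + i) = \<sigma> (n + i))}"
        unfolding \<delta>_def not_le[symmetric] seq_dist_le_power_iff seq_shift_funpow ball by auto
      have "0 < (\<Prod>i<Suc m. measure L {\<rho> i})"
        using \<rho> positive by (intro prod_pos) (auto simp: space_B)
      also have "\<dots> = measure B {\<tau> \<in> space B. \<forall>i<Suc m. \<tau> i = \<rho> i}"
        by (rule measure_cylinder[OF \<rho>, symmetric])
      also have "\<dots> \<le> measure B {\<tau> \<in> space B. (\<forall>i<m. \<tau> i = \<sigma> i) \<and> (\<exists>i<Suc m0. \<not> \<tau> (n + i) = \<sigma> (n + i))}"
      proof (rule B.finite_measure_mono)
        show "{\<tau> \<in> space B. \<forall>i<Suc m. \<tau> i = \<rho> i} \<subseteq>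
            {\<tau> \<in> space B. (\<forall>i<m. \<tau> i = \<sigma> i) \<and> (\<exists>i<Suc m0. \<not> \<tau> (n + i) = \<sigma> (n + i))}"
        proof safe
          fix \<tau> assume \<tau>: "\<forall>i<Suc m. \<tau> i = \<rho> i"
          show "\<tau> i = \<sigma> i" if "i < m" for i using \<tau> that by (simp add: \<rho>_def)
          have "\<tau> m \<noteq> \<sigma> m" using \<tau> t by (simp add: \<rho>_def)
          then show "\<exists>i<Suc m0. \<not> \<tau> (n + i) = \<sigma> (n + i)"
            by (intro exI[of _ "m - n"]) (auto simp: n_def)
        qed
        show "{\<tau> \<in> space B. (\<forall>i<m. \<tau> i = \<sigma> i) \<and> (\<exists>i<Suc m0. \<not> \<tau> (n + i) = \<sigma> (n + i))} \<in> sets B"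
          by measurable
      qed
      finally show ?thesis unfolding eq .
    qed
    ultimately show "\<exists>n. real n \<le> - a * ln (measure B (Metric_space.mball (space B) seq_dist \<sigma> \<epsilon>)) \<and>
        measure B {\<tau> \<in> Metric_space.mball (space B) seq_dist \<sigma> \<epsilon>.
          seq_dist ((seq_shift ^^ n) \<sigma>) ((seq_shift ^^ n) \<tau>) > \<delta>} > 0"
      unfolding ball_def by blast
  qed (use a0 in \<open>auto simp: \<delta>_def\<close>)
  moreover have "\<delta> > 0" by (simp add: \<delta>_def)
  ultimately show ?thesis by blast
qed

theorem minimal_asymptotic_rate_shift:
  "AE \<sigma> in B. minimal_asymptotic_rate B seq_dist seq_shift \<sigma> = ereal (1 / letter_entropy)"
  using information_equipartition AE_space
proof eventually_elim
  case (elim \<sigma>)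
  let ?R = "{ereal a | a. a > 0 \<and> (\<exists>\<delta>>0. sensitivity_pair B seq_dist seq_shift \<sigma> \<delta> a)}"
  have "Inf ?R = ereal (1 / letter_entropy)"
  proof (rule antisym)
    show "ereal (1 / letter_entropy) \<le> Inf ?R"
      using rate_lower_bound[OF elim(2,1)] by (auto intro!: Inf_greatest)
    show "Inf ?R \<le> ereal (1 / letter_entropy)"
    proof (rule ereal_le_epsilon2)
      fix e :: real assume e: "0 < e"
      have "0 < 1 / letter_entropy" using letter_entropy_pos by simp
      with e have "0 < 1 / letter_entropy + e" by linarith
      moreover have "\<exists>\<delta>>0. sensitivity_pair B seq_dist seq_shift \<sigma> \<delta> (1 / letter_entropy + e)"
        using rate_upper_bound[OF elim(2,1)] e by simp
      ultimately have "ereal (1 / letter_entropy + e) \<in> ?R" by blast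
      then have "Inf ?R \<le> ereal (1 / letter_entropy + e)" by (rule Inf_lower)
      then show "Inf ?R \<le> ereal (1 / letter_entropy) + ereal e" by simp
    qed
  qed
  then show ?case by (simp add: minimal_asymptotic_rate_def)
qed

end

theorem proposition3p6:
  fixes N :: nat and M' :: "nat measure"
  assumes "N \<ge> 2"
    and "prob_space M'"
    and "sets M' = Pow {1..N}"
    and "\<And>i. i \<in> {1..N} \<Longrightarrow> measure M' {i} > 0"
  shows "AE \<sigma> in bernoulli_measure M'.
           1 / minimal_asymptotic_rate (bernoulli_measure M') seq_dist seq_shift \<sigma>
             = metric_entropy (bernoulli_measure M') seq_shift"
proof -
  interpret bernoulli_scheme M' "{1..N}"
    using assms by (intro bernoulli_scheme.intro bernoulli_scheme_axioms.intro) auto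
  show ?thesis
    using minimal_asymptotic_rate_shift unfolding metric_entropy_shift[unfolded B_def] B_def
    by eventually_elim (use letter_entropy_pos in \<open>simp add: one_ereal_def\<close>)
qed

end
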